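(* The Jordan plane $R=\mathbb{C}\langle x,y\rangle/(xy-yx-y^2)$ is a representational complete intersection (RCI).
   Context: For an algebra $A=k\langle x_1,\dots,x_d\rangle/(f_1,\dots,f_m)$, the space of $n$-dimensional representations is the closed subvariety $\{(X_1,\dots,X_d)\in M_n(k)^d : f_1(X_1,\dots,X_d)=\dots=f_m(X_1,\dots,X_d)=0\}$ of the affine space $M_n(k)^d$ of dimension $dn^2$, cut out by $mn^2$ polynomial equations (the matrix entries of the $f_j$). It is a complete intersection if its dimension equals $dn^2-mn^2$. The algebra $A$ is called a representational complete intersection (RCI) if for infinitely many $n$ the space of $n$-dimensional representations of $A$ is a (commutative) complete intersection. For $R$ one has $d=2$, $m=1$. *)

theory Defs
  imports
    "HOL-Library.Poly_Mapping"
    "HOL-Library.FuncSet"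
    "HOL-Library.Cardinality"
    "HOL-Library.Extended_Real"
    "HOL-Computational_Algebra.Fundamental_Theorem_Algebra"
    "Jordan_Normal_Form.Matrix"
begin

section \<open>Free algebras\<close>

datatype 'x free_monoid = Word (letters: "'x list")

instantiation free_monoid :: (type) monoid_add
begin

definition "0 = Word []"

definition "v + w = Word (letters v @ letters w)"

instance
  by standard (simp_all add: zero_free_monoid_def plus_free_monoid_def)

end

text \<open>
  The monoid algebra of the free monoid on \<open>'x\<close>: ring structure and unit are those of the
  instances in \<^theory>\<open>HOL-Library.Poly_Mapping\<close> (convolution product). For a finite
  type \<open>'x\<close> with \<open>d\<close> elements this is the free algebra on \<open>d\<close> generators.
\<close>

type_synonym ('x, 'k) free_algebra = "'x free_monoid \<Rightarrow>\<^sub>0 'k"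

definition gen :: "'x \<Rightarrow> ('x, 'k::zero_neq_one) free_algebra" where
  "gen x = Poly_Mapping.single (Word [x]) 1"

definition word_eval :: "nat \<Rightarrow> ('x \<Rightarrow> 'k mat) \<Rightarrow> 'x free_monoid \<Rightarrow> 'k::semiring_1 mat" where
  "word_eval n X w = foldr (\<lambda>x M. X x * M) (letters w) (1\<^sub>m n)"

definition nc_eval :: "nat \<Rightarrow> ('x \<Rightarrow> 'k mat) \<Rightarrow> ('x, 'k) free_algebra \<Rightarrow> 'k::semiring_1 mat" where
  "nc_eval n X f =
     mat n n (\<lambda>ij. \<Sum>w\<in>Poly_Mapping.keys f. Poly_Mapping.lookup f w * word_eval n X w $$ ij)"


section \<open>Closed subvarieties of affine space and their dimension\<close>

text \<open>
  Commutative polynomials in variables \<open>'i\<close> are finitely supported functions on exponent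
  vectors; those with all their variables in \<open>I\<close> are the polynomial functions on the affine
  space \<open>extensional I\<close>, whose coordinates are indexed by \<open>I\<close>.
\<close>

type_synonym ('i, 'k) mpoly = "('i \<Rightarrow>\<^sub>0 nat) \<Rightarrow>\<^sub>0 'k"

definition mpolys_in :: "'i set \<Rightarrow> ('i, 'k::zero) mpoly set" where
  "mpolys_in I = {p. \<forall>m\<in>Poly_Mapping.keys p. Poly_Mapping.keys m \<subseteq> I}"

definition mpoly_eval :: "('i \<Rightarrow> 'k) \<Rightarrow> ('i, 'k) mpoly \<Rightarrow> 'k::comm_semiring_1" where
  "mpoly_eval a p =
     (\<Sum>m\<in>Poly_Mapping.keys p.
        Poly_Mapping.lookup p m * (\<Prod>i\<in>Poly_Mapping.keys m. a i ^ Poly_Mapping.lookup m i))"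

definition zero_locus :: "'i set \<Rightarrow> ('i, 'k::comm_semiring_1) mpoly set \<Rightarrow> ('i \<Rightarrow> 'k) set" where
  "zero_locus I S = {a \<in> extensional I. \<forall>p\<in>S. mpoly_eval a p = 0}"

definition zariski_closed :: "'i set \<Rightarrow> ('i \<Rightarrow> 'k::comm_semiring_1) set \<Rightarrow> bool" where
  "zariski_closed I Z \<longleftrightarrow> (\<exists>S. S \<subseteq> mpolys_in I \<and> Z = zero_locus I S)"

definition irreducible_closed :: "'i set \<Rightarrow> ('i \<Rightarrow> 'k::comm_semiring_1) set \<Rightarrow> bool" where
  "irreducible_closed I Z \<longleftrightarrow>
     zariski_closed I Z \<and> Z \<noteq> {} \<and>
     (\<forall>A B. zariski_closed I A \<longrightarrow> zariski_closed I B \<longrightarrow> Z = A \<union> B \<longrightarrow> Z = A \<or> Z = B)"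

text \<open>
  The Krull dimension of a Zariski closed set \<open>V\<close>: the supremum of the lengths \<open>l\<close> of strictly
  increasing chains \<open>Z 0 \<subset> \<dots> \<subset> Z l\<close> of irreducible closed subsets of \<open>V\<close>. Taking the supremum
  in \<^typ>\<open>ereal\<close> gives the empty variety dimension \<open>-\<infinity>\<close>. As only points with coordinates in
  \<open>'k\<close> are seen, the base field has to be algebraically closed for this to be the dimension of
  the variety.
\<close>

definition variety_dim :: "'i set \<Rightarrow> ('i \<Rightarrow> 'k::alg_closed_field) set \<Rightarrow> ereal" where
  "variety_dim I V =
     (SUP l \<in> {l::nat. \<exists>Z::nat \<Rightarrow> ('i \<Rightarrow> 'k) set.
                  (\<forall>i\<le>l. irreducible_closed I (Z i) \<and> Z i \<subseteq> V) \<and> (\<forall>i<l. Z i \<subset> Z (Suc i))}.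
        ereal (real l))"


section \<open>Representation varieties and representational complete intersections\<close>

text \<open>
  The space of \<open>d\<close>-tuples of \<open>n \<times> n\<close> matrices is the affine space with coordinates
  \<open>(x, i, j)\<close>, standing for the \<open>(i, j)\<close> entry of the matrix at generator \<open>x\<close>.
\<close>

definition mat_coords :: "nat \<Rightarrow> ('x \<times> nat \<times> nat) set" where
  "mat_coords n = UNIV \<times> {..<n} \<times> {..<n}"

definition mat_at :: "nat \<Rightarrow> ('x \<times> nat \<times> nat \<Rightarrow> 'k) \<Rightarrow> 'x \<Rightarrow> 'k mat" where
  "mat_at n a x = mat n n (\<lambda>(i, j). a (x, i, j))"

definition rep_variety ::
  "('x, 'k::semiring_1) free_algebra list \<Rightarrow> nat \<Rightarrow> ('x \<times> nat \<times> nat \<Rightarrow> 'k) set" where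
  "rep_variety fs n =
     {a \<in> extensional (mat_coords n). \<forall>f\<in>set fs. nc_eval n (mat_at n a) f = 0\<^sub>m n n}"

text \<open>
  The expected dimension is \<open>d n\<^sup>2 - m n\<^sup>2\<close>, for \<open>d = CARD('x)\<close> generators and
  \<open>m = length fs\<close> relations; it may be negative, so it is computed in the reals.
\<close>

definition rep_complete_intersection ::
  "('x::finite, 'k::alg_closed_field) free_algebra list \<Rightarrow> nat \<Rightarrow> bool" where
  "rep_complete_intersection fs n \<longleftrightarrow>
     variety_dim (mat_coords n) (rep_variety fs n) =
       ereal (real (CARD('x) * n\<^sup>2) - real (length fs * n\<^sup>2))"

text \<open>RCI for the algebra presented by the generators \<open>'x\<close> and the relations \<open>fs\<close>.\<close>

definition RCI :: "('x::finite, 'k::alg_closed_field) free_algebra list \<Rightarrow> bool" where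
  "RCI fs \<longleftrightarrow> infinite {n. n \<ge> 1 \<and> rep_complete_intersection fs n}"


section \<open>The Jordan plane\<close>

datatype jordan_gen = GenX | GenY

lemma UNIV_jordan_gen: "UNIV = {GenX, GenY}"
  using jordan_gen.exhaust by auto

instance jordan_gen :: finite
  by standard (simp add: UNIV_jordan_gen)

definition jordan_plane_relations :: "(jordan_gen, complex) free_algebra list" where
  "jordan_plane_relations =
     (let x = gen GenX; y = gen GenY in [x * y - y * x - y\<^sup>2])"


section \<open>Unfolding the representation variety of the Jordan plane\<close>

lemma nc_eval_superset:
  assumes "finite K" "Poly_Mapping.keys f \<subseteq> K"
  shows "nc_eval n X f =
    mat n n (\<lambda>ij. \<Sum>w\<in>K. Poly_Mapping.lookup f w * word_eval n X w $$ ij)"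
  unfolding nc_eval_def
  by (intro cong_mat refl sum.mono_neutral_left assms) (auto simp: in_keys_iff)

lemma nc_eval_diff:
  fixes f g :: "('x, 'k::ring_1) free_algebra"
  shows "nc_eval n X (f - g) = nc_eval n X f - nc_eval n X g"
proof -
  let ?K = "Poly_Mapping.keys f \<union> Poly_Mapping.keys g"
  have *: "finite ?K" by simp
  have "Poly_Mapping.keys (f - g) \<subseteq> ?K"
    by (auto simp: in_keys_iff lookup_minus)
  from nc_eval_superset[OF * this]
    nc_eval_superset[OF *, of f] nc_eval_superset[OF *, of g]
  show ?thesis
    by (intro eq_matI) (auto simp: lookup_minus left_diff_distrib sum_subtractf)
qed

lemma nc_eval_two_letters:
  fixes X :: "'x \<Rightarrow> 'k::ring_1 mat"
  assumes "X u \<in> carrier_mat n n" "X v \<in> carrier_mat n n"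
  shows "nc_eval n X (gen u * gen v) = X u * X v"
proof -
  have "gen u * gen v = Poly_Mapping.single (Word [u, v]) (1::'k)"
    by (simp add: gen_def mult_single plus_free_monoid_def)
  then show ?thesis
    using assms by (intro eq_matI) (auto simp: nc_eval_def word_eval_def)
qed

lemma rep_variety_jordan_plane:
  "rep_variety jordan_plane_relations n =
     {a \<in> extensional (mat_coords n).
        let X = mat_at n a GenX; Y = mat_at n a GenY in X * Y - Y * X - Y * Y = 0\<^sub>m n n}"
proof -
  have "mat_at n a z \<in> carrier_mat n n" for a :: "jordan_gen \<times> nat \<times> nat \<Rightarrow> complex" and z
    by (simp add: mat_at_def)
  then show ?thesis
    by (simp add: rep_variety_def jordan_plane_relations_def Let_def power2_eq_square
        nc_eval_diff nc_eval_two_letters)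
qed

end

theory Submission
  imports Defs "HOL-Library.Function_Algebras"
begin

text \<open>
  Write \<open>V\<close> for the set of pairs \<open>(X, Y)\<close> of complex \<open>n \<times> n\<close> matrices with \<open>X Y - Y X = Y\<^sup>2\<close>.
  Its expected dimension is \<open>2 n\<^sup>2 - n\<^sup>2 = n\<^sup>2\<close>, and it has this dimension for every \<open>n\<close>.

  Since \<open>Y = 0\<close> satisfies the equation for all \<open>X\<close>, the variety \<open>V\<close> contains a linear space of
  dimension \<open>n\<^sup>2\<close>. A coordinate subspace is irreducible, and a flag of coordinate subspaces is a
  chain of length \<open>n\<^sup>2\<close> (\<open>variety_dim_ge_coord_subspace\<close>).

  For the upper bound, a chain of \<open>l\<close> strict inclusions of irreducible closed sets produces \<open>l\<close>
  polynomial functions that are algebraically independent on the largest set \<open>Z\<close> of the chain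
  (\<open>chain_alg_independent\<close>). On the other hand, more than \<open>d\<close> rational functions of \<open>d\<close> parameters
  are algebraically dependent (\<open>rational_on_alg_dependent\<close>), where a parameter may be an arbitrary
  function. A relation on a dense subset of \<open>Z\<close>, that is, a subset such that polynomials vanishing
  there vanish on \<open>Z\<close>, holds on \<open>Z\<close>. Hence it suffices to express the entries of \<open>X\<close> and \<open>Y\<close> on a
  dense subset rationally by \<open>n\<^sup>2\<close> parameters (\<open>variety_dim_le\<close>).

  The parameters come from an induction that splits off the kernel of \<open>Y\<close>
  (\<open>jordan_pairs_rational\<close>). For \<open>n > 0\<close> the kernel is not zero: if \<open>Y\<close> had the inverse \<open>W\<close>, then
  \<open>W X - X W = 1\<close>, which contradicts that a commutator has trace \<open>0\<close>. The kernel is invariant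
  under \<open>X\<close>, because \<open>Y X v = X Y v - Y\<^sup>2 v\<close>. Let \<open>r > 0\<close> be its dimension and \<open>m = n - r\<close>. In a basis
  that begins with a basis of the kernel, the matrices become
  \<open>X = (A B; 0 D)\<close> and \<open>Y = (0 C; 0 E)\<close>, and the equation says that \<open>(D, E)\<close> is again a solution,
  of size \<open>m\<close>, and that \<open>(A B) (C; E) = C (D + E)\<close>. By induction, \<open>(D, E)\<close> takes \<open>m\<^sup>2\<close>
  parameters. The position of the kernel takes \<open>r m\<close> of them and \<open>C\<close> takes \<open>r m\<close>. As the \<open>m\<close>
  columns of \<open>(C; E)\<close> are independent, the linear equation determines \<open>m\<close> columns of the
  \<open>r \<times> n\<close> matrix \<open>(A B)\<close> rationally from the other \<open>r\<close> columns, so that \<open>(A B)\<close> takes \<open>r\<^sup>2\<close>.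
  The sum is \<open>(r + m)\<^sup>2 = n\<^sup>2\<close>. The rank of \<open>Y\<close> and the choices of pivots vary with the point, but
  they take finitely many values, so each of them is constant on some dense subset.
\<close>

section \<open>Polynomial functions\<close>

definition monom_eval :: "('i \<Rightarrow> 'k::comm_semiring_1) \<Rightarrow> ('i \<Rightarrow>\<^sub>0 nat) \<Rightarrow> 'k" where
  "monom_eval a m = (\<Prod>i\<in>Poly_Mapping.keys m. a i ^ Poly_Mapping.lookup m i)"

text \<open>
  Sums over a common index set are needed to compare polynomials with different supports.
\<close>

lemma mpoly_eval_superset:
  assumes "finite K" "Poly_Mapping.keys p \<subseteq> K"
  shows "mpoly_eval a p = (\<Sum>m\<in>K. Poly_Mapping.lookup p m * monom_eval a m)"
  unfolding mpoly_eval_def monom_eval_def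
  by (intro sum.mono_neutral_left assms) (auto simp: in_keys_iff)

lemma monom_eval_superset:
  assumes "finite K" "Poly_Mapping.keys m \<subseteq> K"
  shows "monom_eval a m = (\<Prod>i\<in>K. a i ^ Poly_Mapping.lookup m i)"
  unfolding monom_eval_def
  by (intro prod.mono_neutral_left assms) (auto simp: in_keys_iff)

lemma mpoly_eval_zero: "mpoly_eval a 0 = 0"
  by (simp add: mpoly_eval_def)

lemma mpoly_eval_add: "mpoly_eval a (p + q) = mpoly_eval a p + mpoly_eval a q"
proof -
  let ?K = "Poly_Mapping.keys p \<union> Poly_Mapping.keys q"
  have *: "finite ?K" by simp
  from mpoly_eval_superset[OF * Poly_Mapping.keys_add]
    mpoly_eval_superset[OF *, of p] mpoly_eval_superset[OF *, of q]
  show ?thesis by (simp add: lookup_add distrib_right sum.distrib)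
qed

lemma mpoly_eval_sum: "mpoly_eval a (sum g A) = (\<Sum>x\<in>A. mpoly_eval a (g x))"
  by (induction A rule: infinite_finite_induct) (simp_all add: mpoly_eval_zero mpoly_eval_add)

lemma mpoly_eval_single: "mpoly_eval a (Poly_Mapping.single m c) = c * monom_eval a m"
  by (cases "c = 0") (simp_all add: mpoly_eval_def monom_eval_def)

lemma monom_eval_add: "monom_eval a (m + m') = monom_eval a m * monom_eval a m'"
proof -
  let ?K = "Poly_Mapping.keys m \<union> Poly_Mapping.keys m'"
  have *: "finite ?K" by simp
  from monom_eval_superset[OF * Poly_Mapping.keys_add, of a]
    monom_eval_superset[OF *, of m a] monom_eval_superset[OF *, of m' a]
  show ?thesis by (simp add: lookup_add power_add prod.distrib)
qed

lemma mpoly_sum_monomials: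
  fixes p :: "('i, 'k::comm_monoid_add) mpoly"
  shows "p = (\<Sum>m\<in>Poly_Mapping.keys p. Poly_Mapping.single m (Poly_Mapping.lookup p m))"
  by (rule poly_mapping_eqI) (simp add: lookup_sum lookup_single when_def in_keys_iff)

lemma mpoly_eval_mult: "mpoly_eval a (p * q) = mpoly_eval a p * mpoly_eval a q"
proof -
  let ?s = "\<lambda>p m. Poly_Mapping.single m (Poly_Mapping.lookup p m)"
  have "p * q = (\<Sum>m\<in>Poly_Mapping.keys p. ?s p m) * (\<Sum>m\<in>Poly_Mapping.keys q. ?s q m)"
    using mpoly_sum_monomials[of p] mpoly_sum_monomials[of q] by simp
  also have "\<dots> = (\<Sum>m\<in>Poly_Mapping.keys p. \<Sum>m'\<in>Poly_Mapping.keys q. ?s p m * ?s q m')"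
    by (simp add: sum_product)
  finally have "mpoly_eval a (p * q) =
      (\<Sum>m\<in>Poly_Mapping.keys p. Poly_Mapping.lookup p m * monom_eval a m) *
      (\<Sum>m\<in>Poly_Mapping.keys q. Poly_Mapping.lookup q m * monom_eval a m)"
    by (simp add: mpoly_eval_sum mult_single mpoly_eval_single monom_eval_add sum_product
        mult_ac)
  then show ?thesis
    using mpoly_eval_superset[of "Poly_Mapping.keys p" p a]
      mpoly_eval_superset[of "Poly_Mapping.keys q" q a] by simp
qed

definition poly_fun :: "'i set \<Rightarrow> (('i \<Rightarrow> 'k) \<Rightarrow> 'k::comm_semiring_1) \<Rightarrow> bool" where
  "poly_fun I f \<longleftrightarrow> (\<exists>p\<in>mpolys_in I. \<forall>a. f a = mpoly_eval a p)"

lemma poly_fun_mpoly_eval: "p \<in> mpolys_in I \<Longrightarrow> poly_fun I (\<lambda>a. mpoly_eval a p)"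
  by (auto simp: poly_fun_def)

lemma poly_fun_const: "poly_fun I (\<lambda>a. c)"
  unfolding poly_fun_def
  by (rule bexI[of _ "Poly_Mapping.single 0 c"])
    (auto simp: mpoly_eval_single monom_eval_def mpolys_in_def split: if_splits)

lemma poly_fun_add:
  assumes "poly_fun I f" "poly_fun I g"
  shows "poly_fun I (\<lambda>a. f a + g a)"
proof -
  obtain p q where "p \<in> mpolys_in I" "q \<in> mpolys_in I"
    and pq: "\<And>a. f a = mpoly_eval a p" "\<And>a. g a = mpoly_eval a q"
    using assms by (auto simp: poly_fun_def)
  then have "p + q \<in> mpolys_in I"
    using Poly_Mapping.keys_add[of p q] unfolding mpolys_in_def by blast
  then show ?thesis
    by (auto simp: poly_fun_def pq mpoly_eval_add intro!: bexI[of _ "p + q"])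
qed

lemma poly_fun_mult:
  assumes "poly_fun I f" "poly_fun I g"
  shows "poly_fun I (\<lambda>a. f a * g a)"
proof -
  obtain p q where *: "p \<in> mpolys_in I" "q \<in> mpolys_in I"
    and pq: "\<And>a. f a = mpoly_eval a p" "\<And>a. g a = mpoly_eval a q"
    using assms by (auto simp: poly_fun_def)
  have "Poly_Mapping.keys m \<subseteq> I" if m: "m \<in> Poly_Mapping.keys (p * q)" for m
  proof -
    obtain u v where "u \<in> Poly_Mapping.keys p" "v \<in> Poly_Mapping.keys q" "m = u + v"
      using m keys_mult[of p q] by blast
    then show ?thesis
      using * Poly_Mapping.keys_add[of u v] unfolding mpolys_in_def by blast
  qed
  then have "p * q \<in> mpolys_in I" by (auto simp: mpolys_in_def)
  then show ?thesis
    by (auto simp: poly_fun_def pq mpoly_eval_mult intro!: bexI[of _ "p * q"])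
qed

lemma poly_fun_power: "poly_fun I f \<Longrightarrow> poly_fun I (\<lambda>a. f a ^ n)"
  by (induction n) (auto intro: poly_fun_const poly_fun_mult)

lemma poly_fun_sum: "(\<And>x. x \<in> A \<Longrightarrow> poly_fun I (f x)) \<Longrightarrow> poly_fun I (\<lambda>a. \<Sum>x\<in>A. f x a)"
  by (induction A rule: infinite_finite_induct) (auto intro: poly_fun_const poly_fun_add)

lemma poly_fun_prod: "(\<And>x. x \<in> A \<Longrightarrow> poly_fun I (f x)) \<Longrightarrow> poly_fun I (\<lambda>a. \<Prod>x\<in>A. f x a)"
  by (induction A rule: infinite_finite_induct) (auto intro: poly_fun_const poly_fun_mult)

section \<open>Irreducible closed sets and algebraic independence\<close>

lemma zariski_closed_extensional: "zariski_closed I Z \<Longrightarrow> Z \<subseteq> extensional I"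
  by (auto simp: zariski_closed_def zero_locus_def)

lemma zariski_closed_Int_zeros:
  assumes "zariski_closed I Z" "poly_fun I f"
  shows "zariski_closed I {a \<in> Z. f a = 0}"
proof -
  obtain S where S: "S \<subseteq> mpolys_in I" "Z = zero_locus I S"
    using assms by (auto simp: zariski_closed_def)
  obtain p where p: "p \<in> mpolys_in I" "\<And>a. f a = mpoly_eval a p"
    using assms by (auto simp: poly_fun_def)
  have "{a \<in> Z. f a = 0} = zero_locus I (insert p S)"
    by (auto simp: S p zero_locus_def)
  then show ?thesis using S p unfolding zariski_closed_def by blast
qed

lemma zariski_closed_separation:
  assumes "zariski_closed I Z" "a \<in> extensional I" "a \<notin> Z"
  obtains f where "poly_fun I f" "\<And>b. b \<in> Z \<Longrightarrow> f b = 0" "f a \<noteq> 0"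
proof -
  obtain S where S: "S \<subseteq> mpolys_in I" "Z = zero_locus I S"
    using assms by (auto simp: zariski_closed_def)
  then obtain p where "p \<in> S" "mpoly_eval a p \<noteq> 0"
    using assms by (auto simp: zero_locus_def)
  then show ?thesis
    using S by (intro that[of "\<lambda>a. mpoly_eval a p"] poly_fun_mpoly_eval) (auto simp: zero_locus_def)
qed

lemma irreducible_closed_mult_zero:
  fixes f g :: "('i \<Rightarrow> 'k::idom) \<Rightarrow> 'k"
  assumes "irreducible_closed I Z" "poly_fun I f" "poly_fun I g"
    and zero: "\<And>a. a \<in> Z \<Longrightarrow> f a * g a = 0"
  shows "(\<forall>a\<in>Z. f a = 0) \<or> (\<forall>a\<in>Z. g a = 0)"
proof -
  let ?A = "{a \<in> Z. f a = 0}" and ?B = "{a \<in> Z. g a = 0}"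
  have "zariski_closed I ?A" "zariski_closed I ?B"
    using assms by (auto intro!: zariski_closed_Int_zeros simp: irreducible_closed_def)
  moreover have "Z = ?A \<union> ?B" using zero by auto
  ultimately have "Z = ?A \<or> Z = ?B"
    using assms(1) unfolding irreducible_closed_def by blast
  then show ?thesis by blast
qed

text \<open>
  The value of the polynomial with coefficients \<open>c\<close> and exponent vectors in \<open>A\<close> at the functions
  \<open>f 0, \<dots>, f (l - 1)\<close>. The exponent vectors are extensional on \<open>{..<l}\<close> wherever distinct elements of
  \<open>A\<close> have to be distinct monomials.
\<close>

definition poly_at :: "nat \<Rightarrow> (nat \<Rightarrow> 'a \<Rightarrow> 'k) \<Rightarrow> (nat \<Rightarrow> nat) set \<Rightarrow> ((nat \<Rightarrow> nat) \<Rightarrow> 'k) \<Rightarrow> 'a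
    \<Rightarrow> 'k::comm_semiring_1" where
  "poly_at l f A c a = (\<Sum>\<alpha>\<in>A. c \<alpha> * (\<Prod>i<l. f i a ^ \<alpha> i))"

text \<open>
  A polynomial relation on \<open>Z (Suc l)\<close> can be divided by the largest power of \<open>f l\<close> that divides
  it as a formal polynomial, because \<open>Z (Suc l)\<close> is irreducible and \<open>f l\<close> is not zero on it. On
  \<open>Z l\<close>, where \<open>f l\<close> vanishes, the quotient restricts to a nontrivial relation between
  \<open>f 0, \<dots>, f (l - 1)\<close>.
\<close>

lemma chain_alg_independent:
  fixes Z :: "nat \<Rightarrow> ('i \<Rightarrow> 'k::idom) set" and f :: "nat \<Rightarrow> ('i \<Rightarrow> 'k) \<Rightarrow> 'k"
  assumes "\<forall>i\<le>l. irreducible_closed I (Z i)"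
    and "\<forall>i<l. Z i \<subseteq> Z (Suc i) \<and> poly_fun I (f i) \<and> (\<forall>a\<in>Z i. f i a = 0) \<and> (\<exists>a\<in>Z (Suc i). f i a \<noteq> 0)"
    and "finite A" "A \<subseteq> extensional {..<l}"
    and "\<forall>a\<in>Z l. poly_at l f A c a = 0"
  shows "\<forall>\<alpha>\<in>A. c \<alpha> = 0"
  using assms
proof (induction l arbitrary: A c)
  case 0
  then have "A \<subseteq> {\<lambda>_. undefined}" by auto
  then have A: "A = {} \<or> A = {\<lambda>_. undefined}" by blast
  obtain a where "a \<in> Z 0" using 0(1) by (auto simp: irreducible_closed_def)
  with 0(5) have "poly_at 0 f A c a = 0" by blast
  then show ?case using A by (fastforce simp: poly_at_def)
next
  case (Suc l)
  show ?case
  proof (rule ccontr)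
    assume "\<not> (\<forall>\<alpha>\<in>A. c \<alpha> = 0)"
    then obtain \<alpha> where "\<alpha> \<in> A" "c \<alpha> \<noteq> 0" by blast
    define S where "S = {\<alpha>\<in>A. c \<alpha> \<noteq> 0}"
    have S: "finite S" "\<alpha> \<in> S" using Suc.prems(3) \<open>\<alpha> \<in> A\<close> \<open>c \<alpha> \<noteq> 0\<close> by (auto simp: S_def)
    \<comment> \<open>The lowest exponent of \<open>f l\<close>, which is the power that is divided out.\<close>
    define e where "e = Min ((\<lambda>\<alpha>. \<alpha> l) ` S)"
    have e_le: "e \<le> \<beta> l" if "\<beta> \<in> S" for \<beta> using that S by (auto simp: e_def)
    have "e \<in> (\<lambda>\<alpha>. \<alpha> l) ` S" unfolding e_def using S by (intro Min_in) auto
    then obtain \<beta> where \<beta>: "\<beta> \<in> S" "\<beta> l = e" by auto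
    define g where
      "g a = (\<Sum>\<alpha>\<in>S. c \<alpha> * ((\<Prod>i<l. f i a ^ \<alpha> i) * f l a ^ (\<alpha> l - e)))" for a
    have "poly_fun I g"
      unfolding g_def using Suc.prems(2)
      by (intro poly_fun_sum poly_fun_mult poly_fun_prod poly_fun_power poly_fun_const) auto
    moreover have "f l a ^ e * g a = 0" if a: "a \<in> Z (Suc l)" for a
    proof -
      have "f l a ^ e * g a = (\<Sum>\<alpha>\<in>S. c \<alpha> * (\<Prod>i<Suc l. f i a ^ \<alpha> i))"
        unfolding g_def sum_distrib_left
      proof (rule sum.cong[OF refl])
        fix \<alpha> assume "\<alpha> \<in> S"
        from e_le[OF this] have "f l a ^ \<alpha> l = f l a ^ e * f l a ^ (\<alpha> l - e)"
          by (simp flip: power_add)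
        then show "f l a ^ e * (c \<alpha> * ((\<Prod>i<l. f i a ^ \<alpha> i) * f l a ^ (\<alpha> l - e))) =
            c \<alpha> * (\<Prod>i<Suc l. f i a ^ \<alpha> i)"
          by (simp add: mult_ac)
      qed
      also have "\<dots> = poly_at (Suc l) f A c a"
        unfolding poly_at_def using Suc.prems(3) by (intro sum.mono_neutral_left) (auto simp: S_def)
      finally show ?thesis using Suc.prems(5) a by simp
    qed
    ultimately have "(\<forall>a\<in>Z (Suc l). f l a ^ e = 0) \<or> (\<forall>a\<in>Z (Suc l). g a = 0)"
      using Suc.prems(1,2)
      by (intro irreducible_closed_mult_zero[of I] poly_fun_power) auto
    then have g0: "g a = 0" if "a \<in> Z (Suc l)" for a
      using Suc.prems(2) that by auto
    \<comment> \<open>On \<open>Z l\<close> only the terms without \<open>f l\<close> survive in the quotient. Forgetting the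
      exponent of \<open>f l\<close> keeps their monomials distinct.\<close>
    define r where "r \<alpha> = restrict \<alpha> {..<l}" for \<alpha> :: "nat \<Rightarrow> nat"
    define S' where "S' = {\<alpha>\<in>S. \<alpha> l = e}"
    have inj: "inj_on r S'"
    proof (rule inj_onI)
      fix \<alpha> \<beta> assume *: "\<alpha> \<in> S'" "\<beta> \<in> S'" "r \<alpha> = r \<beta>"
      show "\<alpha> = \<beta>"
      proof (rule extensionalityI[of _ "{..<Suc l}"])
        show "\<alpha> \<in> extensional {..<Suc l}" "\<beta> \<in> extensional {..<Suc l}"
          using * Suc.prems(4) by (auto simp: S'_def S_def)
        fix i assume i: "i \<in> {..<Suc l}"
        show "\<alpha> i = \<beta> i"
        proof (cases "i = l")
          case False
          then show ?thesis using fun_cong[OF *(3), of i] i by (simp add: r_def)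
        qed (use * in \<open>simp add: S'_def\<close>)
      qed
    qed
    have r_prod: "(\<Prod>i<l. f i a ^ r \<alpha> i) = (\<Prod>i<l. f i a ^ \<alpha> i)" for a \<alpha>
      by (simp add: r_def)
    have "\<forall>\<gamma>\<in>r ` S'. (c \<circ> inv_into S' r) \<gamma> = 0"
    proof (rule Suc.IH[where A = "r ` S'" and c = "c \<circ> inv_into S' r"])
      show "finite (r ` S')" "r ` S' \<subseteq> extensional {..<l}"
        using S by (auto simp: S'_def r_def)
      have "poly_at l f (r ` S') (c \<circ> inv_into S' r) a = 0" if a: "a \<in> Z l" for a
      proof -
        have "poly_at l f (r ` S') (c \<circ> inv_into S' r) a =
            (\<Sum>\<alpha>\<in>S'. c \<alpha> * (\<Prod>i<l. f i a ^ \<alpha> i))"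
          unfolding poly_at_def sum.reindex[OF inj]
          by (intro sum.cong) (simp_all add: inv_into_f_f[OF inj] r_prod)
        also have "\<dots> = (\<Sum>\<alpha>\<in>S'. c \<alpha> * ((\<Prod>i<l. f i a ^ \<alpha> i) * f l a ^ (\<alpha> l - e)))"
          by (intro sum.cong) (auto simp: S'_def)
        also have "\<dots> = g a"
          unfolding g_def using S e_le Suc.prems(2) a
          by (intro sum.mono_neutral_left) (force simp: S'_def le_less)+
        also have "\<dots> = 0" using g0 Suc.prems(2) a by auto
        finally show ?thesis .
      qed
      then show "\<forall>a\<in>Z l. poly_at l f (r ` S') (c \<circ> inv_into S' r) a = 0" by blast
    qed (use Suc.prems(1,2) in auto)
    moreover have "\<beta> \<in> S'" using \<beta> by (simp add: S'_def)
    ultimately show False using inj by (auto simp: S'_def S_def)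
  qed
qed

section \<open>A lower bound for the dimension\<close>

definition coord_subspace :: "'i set \<Rightarrow> 'i set \<Rightarrow> ('i \<Rightarrow> 'k::zero) set" where
  "coord_subspace I K = {a \<in> extensional I. \<forall>i\<in>I - K. a i = 0}"

lemma poly_fun_on_line:
  fixes f :: "('i \<Rightarrow> 'k::comm_ring_1) \<Rightarrow> 'k"
  assumes "poly_fun I f"
  obtains p where "\<And>s. f (\<lambda>i\<in>I. a i + s * b i) = poly p s"
proof -
  obtain q where q: "q \<in> mpolys_in I" "\<And>a. f a = mpoly_eval a q"
    using assms by (auto simp: poly_fun_def)
  let ?p = "\<Sum>m\<in>Poly_Mapping.keys q. [:Poly_Mapping.lookup q m:] *
      (\<Prod>i\<in>Poly_Mapping.keys m. [:a i, b i:] ^ Poly_Mapping.lookup m i)"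
  have "f (\<lambda>i\<in>I. a i + s * b i) = poly ?p s" for s
    unfolding q(2) mpoly_eval_def poly_sum poly_mult poly_prod poly_power
  proof (intro sum.cong refl arg_cong2[of _ _ _ _ "(*)"] prod.cong)
    fix m i assume "m \<in> Poly_Mapping.keys q" "i \<in> Poly_Mapping.keys m"
    then have "i \<in> I" using q(1) by (auto simp: mpolys_in_def)
    then show "(\<lambda>i\<in>I. a i + s * b i) i ^ Poly_Mapping.lookup m i =
        poly [:a i, b i:] s ^ Poly_Mapping.lookup m i"
      by simp
  qed simp
  then show ?thesis using that by blast
qed

lemma coord_subspace_mono: "K \<subseteq> K' \<Longrightarrow> coord_subspace I K \<subseteq> coord_subspace I K'"
  by (auto simp: coord_subspace_def)

text \<open>
  If proper closed subsets \<open>A\<close> and \<open>B\<close> covered the linear space, then so would they cover the line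
  through a point outside \<open>A\<close> and a point outside \<open>B\<close>. On the line, equations of \<open>A\<close> and \<open>B\<close> become
  nonzero univariate polynomials, whose product has only finitely many roots.
\<close>

lemma irreducible_coord_subspace:
  assumes inf: "infinite (UNIV :: 'k::idom set)"
  shows "irreducible_closed I (coord_subspace I K :: ('i \<Rightarrow> 'k) set)" (is "irreducible_closed I ?L")
  unfolding irreducible_closed_def
proof (intro conjI allI impI)
  let ?var = "\<lambda>i. Poly_Mapping.single (Poly_Mapping.single i 1) 1 :: ('i, 'k) mpoly"
  have "?L = zero_locus I (?var ` (I - K))"
    by (auto simp: coord_subspace_def zero_locus_def mpoly_eval_def)
  moreover have "?var ` (I - K) \<subseteq> mpolys_in I" by (auto simp: mpolys_in_def)
  ultimately show "zariski_closed I ?L" unfolding zariski_closed_def by blast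
  have "(\<lambda>i\<in>I. 0) \<in> ?L" by (auto simp: coord_subspace_def)
  then show "?L \<noteq> {}" by blast
next
  fix A B :: "('i \<Rightarrow> 'k) set"
  assume A: "zariski_closed I A" and B: "zariski_closed I B" and L: "?L = A \<union> B"
  show "?L = A \<or> ?L = B"
  proof (rule ccontr)
    assume "\<not> ?thesis"
    then obtain a b where a: "a \<in> ?L" "a \<notin> A" and b: "b \<in> ?L" "b \<notin> B" using L by blast
    obtain f where f: "poly_fun I f" "\<And>x. x \<in> A \<Longrightarrow> f x = 0" "f a \<noteq> 0"
      using zariski_closed_separation[OF A _ a(2)] a(1) by (auto simp: coord_subspace_def)
    obtain g where g: "poly_fun I g" "\<And>x. x \<in> B \<Longrightarrow> g x = 0" "g b \<noteq> 0"
      using zariski_closed_separation[OF B _ b(2)] b(1) by (auto simp: coord_subspace_def)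
    define line where "line s = (\<lambda>i\<in>I. a i + s * (b i - a i))" for s
    have line: "line s \<in> ?L" for s
      using a(1) b(1) by (auto simp: line_def coord_subspace_def)
    have ends: "line 0 = a" "line 1 = b"
      using a(1) b(1)
      by (auto simp: line_def coord_subspace_def restrict_def extensional_def fun_eq_iff)
    obtain p q where p: "\<And>s. f (line s) = poly p s" and q: "\<And>s. g (line s) = poly q s"
      unfolding line_def using poly_fun_on_line[OF f(1)] poly_fun_on_line[OF g(1)] by metis
    have "p \<noteq> 0" "q \<noteq> 0" using p[of 0] q[of 1] f(3) g(3) ends by auto
    then have "finite {s. poly (p * q) s = 0}" by (intro poly_roots_finite) simp
    moreover have "poly (p * q) s = 0" for s
    proof -
      have "line s \<in> A \<or> line s \<in> B" using line L by blast
      then show ?thesis using f(2)[of "line s"] g(2)[of "line s"] by (auto simp flip: p q)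
    qed
    ultimately show False using inf by (simp del: poly_mult)
  qed
qed

lemma variety_dim_ge_coord_subspace:
  fixes V :: "('i \<Rightarrow> 'k::alg_closed_field) set"
  assumes inf: "infinite (UNIV :: 'k set)"
    and "finite K" "K \<subseteq> I" and V: "coord_subspace I K \<subseteq> V"
  shows "ereal (real (card K)) \<le> variety_dim I V"
proof -
  obtain h where h: "bij_betw h {..<card K} K"
    using ex_bij_betw_nat_finite[OF \<open>finite K\<close>] by (auto simp: atLeast0LessThan)
  define Z :: "nat \<Rightarrow> ('i \<Rightarrow> 'k) set" where "Z k = coord_subspace I (h ` {..<k})" for k
  have hK: "h ` {..<k} \<subseteq> K" if "k \<le> card K" for k
    using h that by (auto simp: bij_betw_def)
  have "irreducible_closed I (Z k) \<and> Z k \<subseteq> V" if "k \<le> card K" for k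
  proof -
    have "Z k \<subseteq> coord_subspace I K"
      unfolding Z_def by (intro coord_subspace_mono hK that)
    then show ?thesis using irreducible_coord_subspace[OF inf] V by (auto simp: Z_def)
  qed
  moreover have "Z k \<subset> Z (Suc k)" if k: "k < card K" for k
  proof -
    have "h k \<notin> h ` {..<k}"
      using h k by (auto simp: bij_betw_def dest!: inj_onD[of h])
    moreover have "h k \<in> I" using hK[of "Suc k"] k \<open>K \<subseteq> I\<close> by auto
    ultimately have "(\<lambda>i\<in>I. if i = h k then 1 else 0) \<in> Z (Suc k) - Z k"
      by (auto simp: Z_def coord_subspace_def)
    moreover have "Z k \<subseteq> Z (Suc k)" unfolding Z_def by (intro coord_subspace_mono) auto
    ultimately show ?thesis by blast
  qed
  ultimately show ?thesis
    unfolding variety_dim_def by (intro SUP_upper) auto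
qed

section \<open>Rational functions of finitely many parameters\<close>

text \<open>
  The functions on \<open>P\<close> that are obtained from constants and the parameters in \<open>T\<close> by field
  operations. The parameters are arbitrary functions, so that they can involve choices made
  separately at each point. Rule \<open>cong\<close> makes this a property of the restriction to \<open>P\<close>.
\<close>

inductive rational_on :: "'a set \<Rightarrow> ('a \<Rightarrow> 'k::field) set \<Rightarrow> ('a \<Rightarrow> 'k) \<Rightarrow> bool"
  for P :: "'a set" and T :: "('a \<Rightarrow> 'k::field) set" where
  const: "rational_on P T (\<lambda>_. c)"
| base: "t \<in> T \<Longrightarrow> rational_on P T t"
| add: "rational_on P T f \<Longrightarrow> rational_on P T g \<Longrightarrow> rational_on P T (\<lambda>a. f a + g a)"
| mult: "rational_on P T f \<Longrightarrow> rational_on P T g \<Longrightarrow> rational_on P T (\<lambda>a. f a * g a)"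
| inverse: "rational_on P T f \<Longrightarrow> (\<And>a. a \<in> P \<Longrightarrow> f a \<noteq> 0) \<Longrightarrow> rational_on P T (\<lambda>a. inverse (f a))"
| cong: "rational_on P T f \<Longrightarrow> (\<And>a. a \<in> P \<Longrightarrow> g a = f a) \<Longrightarrow> rational_on P T g"

lemma rational_on_trans:
  assumes "rational_on P T f" "P' \<subseteq> P" "\<And>t. t \<in> T \<Longrightarrow> rational_on P' T' t"
  shows "rational_on P' T' f"
  using assms(1)
proof induction
  case (cong f g)
  then show ?case using assms(2) by (blast intro: rational_on.cong)
next
  case (inverse f)
  then show ?case using assms(2) by (blast intro: rational_on.inverse)
qed (auto intro: assms rational_on.intros)

lemma rational_on_mono:
  "rational_on P T f \<Longrightarrow> P' \<subseteq> P \<Longrightarrow> T \<subseteq> T' \<Longrightarrow> rational_on P' T' f"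
  by (erule rational_on_trans) (auto intro: rational_on.base)

lemma rational_on_uminus: "rational_on P T f \<Longrightarrow> rational_on P T (\<lambda>a. - f a)"
  using rational_on.mult[OF rational_on.const[of P T "-1"]] by simp

lemma rational_on_diff:
  "rational_on P T f \<Longrightarrow> rational_on P T g \<Longrightarrow> rational_on P T (\<lambda>a. f a - g a)"
  using rational_on.add[OF _ rational_on_uminus] by simp

lemma rational_on_divide:
  "rational_on P T f \<Longrightarrow> rational_on P T g \<Longrightarrow> (\<And>a. a \<in> P \<Longrightarrow> g a \<noteq> 0) \<Longrightarrow>
    rational_on P T (\<lambda>a. f a / g a)"
  unfolding divide_inverse by (intro rational_on.mult rational_on.inverse)

lemma rational_on_sum:
  "(\<And>x. x \<in> A \<Longrightarrow> rational_on P T (f x)) \<Longrightarrow> rational_on P T (\<lambda>a. \<Sum>x\<in>A. f x a)"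
  by (induction A rule: infinite_finite_induct) (auto intro: rational_on.intros)

lemma rational_on_prod:
  "(\<And>x. x \<in> A \<Longrightarrow> rational_on P T (f x)) \<Longrightarrow> rational_on P T (\<lambda>a. \<Prod>x\<in>A. f x a)"
  by (induction A rule: infinite_finite_induct) (auto intro: rational_on.intros)

lemma rational_on_power: "rational_on P T f \<Longrightarrow> rational_on P T (\<lambda>a. f a ^ n)"
  by (induction n) (auto intro: rational_on.intros)

lemma rational_on_poly_fun:
  assumes f: "poly_fun I f" and "\<And>i. i \<in> I \<Longrightarrow> rational_on P T (\<lambda>a. a i)"
  shows "rational_on P T f"
proof -
  obtain p where p: "p \<in> mpolys_in I" and "\<And>a. f a = mpoly_eval a p"
    using f by (auto simp: poly_fun_def)
  then have "f = (\<lambda>a. mpoly_eval a p)" by auto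
  moreover have "rational_on P T (\<lambda>a. mpoly_eval a p)"
    unfolding mpoly_eval_def using p assms(2)
    by (intro rational_on_sum rational_on.mult rational_on.const rational_on_prod rational_on_power)
      (auto simp: mpolys_in_def)
  ultimately show ?thesis by simp
qed

text \<open>
  Polynomials in the parameters with degree at most \<open>M\<close> in each of them: this filtration has
  \<open>(M + 1) ^ card T\<close> monomials in degree \<open>M\<close>.
\<close>

inductive poly_deg :: "('a \<Rightarrow> 'k::field) set \<Rightarrow> nat \<Rightarrow> ('a \<Rightarrow> 'k) \<Rightarrow> bool"
  for T :: "('a \<Rightarrow> 'k::field) set" and M :: nat where
  monomial: "(\<And>t. t \<in> T \<Longrightarrow> \<beta> t \<le> M) \<Longrightarrow> poly_deg T M (\<lambda>a. c * (\<Prod>t\<in>T. t a ^ \<beta> t))"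
| add: "poly_deg T M f \<Longrightarrow> poly_deg T M g \<Longrightarrow> poly_deg T M (\<lambda>a. f a + g a)"

lemma poly_deg_const: "poly_deg T M (\<lambda>_. c)"
  using poly_deg.monomial[of T "\<lambda>_. 0" M c] by simp

lemma poly_deg_base:
  assumes "finite T" "t \<in> T"
  shows "poly_deg T (Suc 0) t"
proof (rule back_subst[where P = "poly_deg T (Suc 0)"])
  let ?\<beta> = "\<lambda>t'. if t' = t then Suc 0 else 0"
  show "poly_deg T (Suc 0) (\<lambda>a. 1 * (\<Prod>t'\<in>T. t' a ^ ?\<beta> t'))"
    by (rule poly_deg.monomial) simp
  have "(\<Prod>t'\<in>T. t' a ^ ?\<beta> t') = (\<Prod>t'\<in>T. if t' = t then t' a else 1)" for a
    by (intro prod.cong) auto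
  also have "(\<Prod>t'\<in>T. if t' = t then t' a else 1) = t a" for a
    using assms by simp
  finally show "(\<lambda>a. 1 * (\<Prod>t'\<in>T. t' a ^ ?\<beta> t')) = t" by (intro ext) simp
qed

lemma poly_deg_mult:
  assumes "poly_deg T M f" "poly_deg T M' g"
  shows "poly_deg T (M + M') (\<lambda>a. f a * g a)"
  using assms(1)
proof induction
  case (monomial \<beta> c)
  from assms(2) show ?case
  proof induction
    case (monomial \<gamma> d)
    have "poly_deg T (M + M') (\<lambda>a. (c * d) * (\<Prod>t\<in>T. t a ^ (\<beta> t + \<gamma> t)))"
      using monomial \<open>\<And>t. t \<in> T \<Longrightarrow> \<beta> t \<le> M\<close> by (intro poly_deg.monomial add_mono) auto
    then show ?case by (simp add: power_add prod.distrib mult_ac)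
  next
    case (add f g)
    show ?case unfolding distrib_left by (rule poly_deg.add[OF add.IH])
  qed
next
  case (add f g)
  show ?case unfolding distrib_right by (rule poly_deg.add[OF add.IH])
qed

lemma poly_deg_power: "poly_deg T M f \<Longrightarrow> poly_deg T (n * M) (\<lambda>a. f a ^ n)"
  by (induction n) (auto intro: poly_deg_const poly_deg_mult)

lemma poly_deg_prod:
  "(\<And>x. x \<in> A \<Longrightarrow> poly_deg T (M x) (f x)) \<Longrightarrow> poly_deg T (\<Sum>x\<in>A. M x) (\<lambda>a. \<Prod>x\<in>A. f x a)"
  by (induction A rule: infinite_finite_induct) (auto intro: poly_deg_const poly_deg_mult)

lemma poly_deg_coeffs:
  assumes "finite T" "poly_deg T M f"
  shows "\<exists>c. \<forall>a. f a = (\<Sum>\<beta>\<in>T \<rightarrow>\<^sub>E {..M}. c \<beta> * (\<Prod>t\<in>T. t a ^ \<beta> t))"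
  using assms(2)
proof induction
  case (monomial \<beta> d)
  let ?c = "\<lambda>\<gamma>. if \<gamma> = restrict \<beta> T then d else 0"
  have "d * (\<Prod>t\<in>T. t a ^ \<beta> t) = (\<Sum>\<gamma>\<in>T \<rightarrow>\<^sub>E {..M}. ?c \<gamma> * (\<Prod>t\<in>T. t a ^ \<gamma> t))" for a
  proof -
    have "(\<Sum>\<gamma>\<in>T \<rightarrow>\<^sub>E {..M}. ?c \<gamma> * (\<Prod>t\<in>T. t a ^ \<gamma> t)) =
        (\<Sum>\<gamma>\<in>T \<rightarrow>\<^sub>E {..M}. if \<gamma> = restrict \<beta> T then d * (\<Prod>t\<in>T. t a ^ \<gamma> t) else 0)"
      by (intro sum.cong) auto
    also have "\<dots> = d * (\<Prod>t\<in>T. t a ^ \<beta> t)"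
      using monomial assms(1) by (subst sum.delta) (auto intro!: finite_PiE)
    finally show ?thesis by simp
  qed
  then show ?case by (intro exI[of _ ?c] allI)
next
  case (add f g)
  obtain c where c: "\<forall>a. f a = (\<Sum>\<beta>\<in>T \<rightarrow>\<^sub>E {..M}. c \<beta> * (\<Prod>t\<in>T. t a ^ \<beta> t))"
    using add.IH(1) by (elim exE)
  obtain d where d: "\<forall>a. g a = (\<Sum>\<beta>\<in>T \<rightarrow>\<^sub>E {..M}. d \<beta> * (\<Prod>t\<in>T. t a ^ \<beta> t))"
    using add.IH(2) by (elim exE)
  show ?case
    by (intro exI[of _ "\<lambda>\<beta>. c \<beta> + d \<beta>"]) (simp add: c d distrib_right sum.distrib)
qed

lemma rational_on_fraction:
  assumes "finite T" "rational_on P T f"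
  shows "\<exists>M p q. poly_deg T M p \<and> poly_deg T M q \<and> (\<forall>a\<in>P. q a \<noteq> 0 \<and> f a = p a / q a)"
  using assms(2)
proof induction
  case (const c)
  show ?case
    by (intro exI[of _ 0] exI[of _ "\<lambda>_. c"] exI[of _ "\<lambda>_. 1"]) (simp add: poly_deg_const)
next
  case (base t)
  then show ?case
    by (intro exI[of _ "Suc 0"] exI[of _ t] exI[of _ "\<lambda>_. 1"])
      (simp add: poly_deg_const poly_deg_base assms)
next
  case (add f g)
  obtain M p q where 1: "poly_deg T M p" "poly_deg T M q"
    "\<forall>a\<in>P. q a \<noteq> 0 \<and> f a = p a / q a" using add.IH(1) by auto
  obtain M' p' q' where 2: "poly_deg T M' p'" "poly_deg T M' q'"
    "\<forall>a\<in>P. q' a \<noteq> 0 \<and> g a = p' a / q' a" using add.IH(2) by auto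
  have "poly_deg T (M + M') (\<lambda>a. p a * q' a + q a * p' a)"
    by (intro poly_deg.add poly_deg_mult 1 2)
  moreover have "poly_deg T (M + M') (\<lambda>a. q a * q' a)" by (intro poly_deg_mult 1 2)
  moreover have "\<forall>a\<in>P. q a * q' a \<noteq> 0 \<and> f a + g a = (p a * q' a + q a * p' a) / (q a * q' a)"
    using 1(3) 2(3) by (simp add: add_frac_eq)
  ultimately show ?case by blast
next
  case (mult f g)
  obtain M p q where 1: "poly_deg T M p" "poly_deg T M q"
    "\<forall>a\<in>P. q a \<noteq> 0 \<and> f a = p a / q a" using mult.IH(1) by auto
  obtain M' p' q' where 2: "poly_deg T M' p'" "poly_deg T M' q'"
    "\<forall>a\<in>P. q' a \<noteq> 0 \<and> g a = p' a / q' a" using mult.IH(2) by auto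
  have "poly_deg T (M + M') (\<lambda>a. p a * p' a)" by (intro poly_deg_mult 1 2)
  moreover have "poly_deg T (M + M') (\<lambda>a. q a * q' a)" by (intro poly_deg_mult 1 2)
  moreover have "\<forall>a\<in>P. q a * q' a \<noteq> 0 \<and> f a * g a = (p a * p' a) / (q a * q' a)"
    using 1(3) 2(3) by simp
  ultimately show ?case by blast
next
  case (inverse f)
  obtain M p q where 1: "poly_deg T M p" "poly_deg T M q"
    "\<forall>a\<in>P. q a \<noteq> 0 \<and> f a = p a / q a" using inverse.IH by auto
  then have "\<forall>a\<in>P. p a \<noteq> 0 \<and> Fields.inverse (f a) = q a / p a" using inverse.hyps by auto
  with 1 show ?case by blast
next
  case (cong f g)
  then show ?case by (metis (no_types))
qed

text \<open>
  A homogeneous system with fewer equations than unknowns, solved by eliminating the unknown \<open>p\<close>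
  from one equation.
\<close>

lemma nontrivial_solution:
  fixes m :: "'a \<Rightarrow> 'b \<Rightarrow> 'k::field"
  assumes "finite B" "finite A" "card B < card A"
  shows "\<exists>c. (\<exists>a\<in>A. c a \<noteq> 0) \<and> (\<forall>b\<in>B. (\<Sum>a\<in>A. c a * m a b) = 0)"
  using assms
proof (induction B arbitrary: A m rule: finite_induct)
  case empty
  then have "A \<noteq> {}" by auto
  then show ?case by (intro exI[of _ "\<lambda>_. 1"]) auto
next
  case (insert b B)
  show ?case
  proof (cases "\<exists>p\<in>A. m p b \<noteq> 0")
    case False
    obtain c where "\<exists>a\<in>A. c a \<noteq> 0" "\<forall>b\<in>B. (\<Sum>a\<in>A. c a * m a b) = 0"
      using insert.IH[of A m] insert.prems insert.hyps by auto
    then show ?thesis using False by (intro exI[of _ c]) auto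
  next
    case True
    then obtain p where p: "p \<in> A" "m p b \<noteq> 0" by blast
    have "card B < card (A - {p})" using insert.prems insert.hyps p by simp
    then obtain c where c: "\<exists>a\<in>A - {p}. c a \<noteq> 0"
      "\<forall>b'\<in>B. (\<Sum>a\<in>A - {p}. c a * (m a b' - m a b / m p b * m p b')) = 0"
      using insert.IH[of "A - {p}" "\<lambda>a b'. m a b' - m a b / m p b * m p b'"] insert.prems by auto
    define c' where "c' = c(p := - (\<Sum>a\<in>A - {p}. c a * m a b) / m p b)"
    have split: "(\<Sum>a\<in>A. c' a * m a b') = c' p * m p b' + (\<Sum>a\<in>A - {p}. c a * m a b')" for b'
      using insert.prems p by (subst sum.remove[of A p]) (auto simp: c'_def intro!: sum.cong)
    have c'p: "c' p = - (\<Sum>a\<in>A - {p}. c a * m a b) / m p b" by (simp add: c'_def)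
    have "(\<Sum>a\<in>A. c' a * m a b') = 0" if "b' \<in> insert b B" for b'
    proof (cases "b' = b")
      case True
      then show ?thesis using p by (simp add: split c'p)
    next
      case False
      have "0 = (\<Sum>a\<in>A - {p}. c a * (m a b' - m a b / m p b * m p b'))"
        using c(2) that False by simp
      also have "\<dots> = (\<Sum>a\<in>A - {p}. c a * m a b') - (\<Sum>a\<in>A - {p}. c a * m a b) / m p b * m p b'"
        by (simp add: right_diff_distrib sum_subtractf sum_divide_distrib sum_distrib_right
            mult.assoc)
      finally show ?thesis by (simp add: split c'p)
    qed
    moreover have "\<exists>a\<in>A. c' a \<noteq> 0" using c(1) by (auto simp: c'_def)
    ultimately show ?thesis by blast
  qed
qed

text \<open>
  Count monomials: after multiplication with a common denominator, the \<open>(N + 1) ^ l\<close> monomials with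
  exponents at most \<open>N\<close> in the \<open>l\<close> functions become polynomials of degree at most \<open>N K\<close> in each of
  the \<open>d = card T\<close> parameters, where \<open>K\<close> does not depend on \<open>N\<close>. These lie in the span of only
  \<open>(N K + 1) ^ d\<close> monomials, which is a smaller number for large \<open>N\<close> if \<open>d < l\<close>.
\<close>

lemma rational_on_alg_dependent:
  fixes g :: "nat \<Rightarrow> 'a \<Rightarrow> 'k::field"
  assumes T: "finite T" "card T < l" and "\<And>i. i < l \<Longrightarrow> rational_on P T (g i)"
  shows "\<exists>A c. finite A \<and> A \<subseteq> extensional {..<l} \<and> (\<exists>\<alpha>\<in>A. c \<alpha> \<noteq> 0) \<and>
    (\<forall>a\<in>P. poly_at l g A c a = 0)"
proof -
  have "\<forall>i\<in>{..<l}. \<exists>M p q. poly_deg T M p \<and> poly_deg T M q \<and>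
      (\<forall>a\<in>P. q a \<noteq> 0 \<and> g i a = p a / q a)"
    using rational_on_fraction[OF T(1) assms(3)] by simp
  then have "\<exists>M. \<forall>i\<in>{..<l}. \<exists>p q. poly_deg T (M i) p \<and> poly_deg T (M i) q \<and>
      (\<forall>a\<in>P. q a \<noteq> 0 \<and> g i a = p a / q a)"
    by (rule bchoice)
  then obtain M where "\<forall>i\<in>{..<l}. \<exists>p q. poly_deg T (M i) p \<and> poly_deg T (M i) q \<and>
      (\<forall>a\<in>P. q a \<noteq> 0 \<and> g i a = p a / q a)" ..
  then have "\<exists>p. \<forall>i\<in>{..<l}. \<exists>q. poly_deg T (M i) (p i) \<and> poly_deg T (M i) q \<and>
      (\<forall>a\<in>P. q a \<noteq> 0 \<and> g i a = p i a / q a)"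
    by (rule bchoice)
  then obtain p where "\<forall>i\<in>{..<l}. \<exists>q. poly_deg T (M i) (p i) \<and> poly_deg T (M i) q \<and>
      (\<forall>a\<in>P. q a \<noteq> 0 \<and> g i a = p i a / q a)" ..
  then have "\<exists>q. \<forall>i\<in>{..<l}. poly_deg T (M i) (p i) \<and> poly_deg T (M i) (q i) \<and>
      (\<forall>a\<in>P. q i a \<noteq> 0 \<and> g i a = p i a / q i a)"
    by (rule bchoice)
  then obtain q where pq: "\<forall>i\<in>{..<l}. poly_deg T (M i) (p i) \<and> poly_deg T (M i) (q i) \<and>
      (\<forall>a\<in>P. q i a \<noteq> 0 \<and> g i a = p i a / q i a)" ..
  define K where "K = (\<Sum>i<l. M i)"
  \<comment> \<open>With this \<open>N\<close> one has \<open>((N + 1) (K + 1)) ^ d = (N + 1) ^ d * N < (N + 1) ^ (d + 1)\<close>.\<close>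
  define N where "N = (K + 1) ^ card T"
  define A where "A = {..<l} \<rightarrow>\<^sub>E {..N}"
  define B where "B = T \<rightarrow>\<^sub>E {..N * K}"
  have fin: "finite A" "finite B" using T by (auto simp: A_def B_def intro!: finite_PiE)
  have "card B = (N * K + 1) ^ card T" using T by (simp add: B_def card_PiE)
  also have "\<dots> \<le> ((N + 1) * (K + 1)) ^ card T" by (intro power_mono) auto
  also have "\<dots> = (N + 1) ^ card T * N"
    unfolding power_mult_distrib N_def[symmetric] ..
  also have "\<dots> < (N + 1) ^ card T * (N + 1)" by simp
  also have "\<dots> \<le> (N + 1) ^ l"
    using T power_increasing[of "Suc (card T)" l "N + 1"] by (simp add: mult.commute)
  also have "\<dots> = card A" by (simp add: A_def card_PiE)
  finally have card: "card B < card A" .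
  \<comment> \<open>The monomial \<open>\<alpha>\<close> in the functions \<open>g i = p i / q i\<close>, multiplied with the common
    denominator \<open>Q = \<Prod>i<l. q i ^ N\<close> of all these monomials.\<close>
  define h where "h \<alpha> a = (\<Prod>i<l. p i a ^ \<alpha> i * q i a ^ (N - \<alpha> i))" for \<alpha> a
  have "poly_deg T (N * K) (h \<alpha>)" if "\<alpha> \<in> A" for \<alpha>
  proof -
    have "poly_deg T (\<Sum>i<l. \<alpha> i * M i + (N - \<alpha> i) * M i) (h \<alpha>)"
      unfolding h_def using pq by (intro poly_deg_prod poly_deg_mult poly_deg_power) auto
    moreover have "(\<Sum>i<l. \<alpha> i * M i + (N - \<alpha> i) * M i) = N * K"
      unfolding K_def sum_distrib_left using that
      by (intro sum.cong refl) (auto simp: A_def PiE_iff simp flip: distrib_right)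
    ultimately show ?thesis by simp
  qed
  then have "\<forall>\<alpha>\<in>A. \<exists>m. \<forall>a. h \<alpha> a = (\<Sum>\<beta>\<in>B. m \<beta> * (\<Prod>t\<in>T. t a ^ \<beta> t))"
    unfolding B_def using poly_deg_coeffs[OF T(1)] by blast
  then have "\<exists>m. \<forall>\<alpha>\<in>A. \<forall>a. h \<alpha> a = (\<Sum>\<beta>\<in>B. m \<alpha> \<beta> * (\<Prod>t\<in>T. t a ^ \<beta> t))"
    by (rule bchoice)
  then obtain m where m: "\<forall>\<alpha>\<in>A. \<forall>a. h \<alpha> a = (\<Sum>\<beta>\<in>B. m \<alpha> \<beta> * (\<Prod>t\<in>T. t a ^ \<beta> t))" ..
  obtain c where c: "(\<exists>\<alpha>\<in>A. c \<alpha> \<noteq> 0) \<and> (\<forall>\<beta>\<in>B. (\<Sum>\<alpha>\<in>A. c \<alpha> * m \<alpha> \<beta>) = 0)"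
    using nontrivial_solution[OF fin(2,1) card, of m] ..
  have "poly_at l g A c a = 0" if a: "a \<in> P" for a
  proof -
    define Q where "Q = (\<Prod>i<l. q i a ^ N)"
    have "Q \<noteq> 0" using pq a by (auto simp: Q_def)
    have "(\<Prod>i<l. g i a ^ \<alpha> i) * Q = h \<alpha> a" if "\<alpha> \<in> A" for \<alpha>
      unfolding Q_def h_def prod.distrib[symmetric]
    proof (intro prod.cong refl)
      fix i assume "i \<in> {..<l}"
      then have "\<alpha> i \<le> N" "q i a \<noteq> 0" "g i a = p i a / q i a"
        using that pq a by (auto simp: A_def PiE_iff)
      then show "g i a ^ \<alpha> i * q i a ^ N = p i a ^ \<alpha> i * q i a ^ (N - \<alpha> i)"
        by (simp add: power_divide power_diff)
    qed
    then have "poly_at l g A c a * Q = (\<Sum>\<alpha>\<in>A. c \<alpha> * h \<alpha> a)"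
      by (simp add: poly_at_def sum_distrib_right mult.assoc)
    also have "\<dots> = (\<Sum>\<beta>\<in>B. (\<Sum>\<alpha>\<in>A. c \<alpha> * m \<alpha> \<beta>) * (\<Prod>t\<in>T. t a ^ \<beta> t))"
    proof -
      have "(\<Sum>\<alpha>\<in>A. c \<alpha> * h \<alpha> a) =
          (\<Sum>\<alpha>\<in>A. \<Sum>\<beta>\<in>B. c \<alpha> * m \<alpha> \<beta> * (\<Prod>t\<in>T. t a ^ \<beta> t))"
        by (intro sum.cong refl) (simp add: m sum_distrib_left mult.assoc)
      also have "\<dots> = (\<Sum>\<beta>\<in>B. \<Sum>\<alpha>\<in>A. c \<alpha> * m \<alpha> \<beta> * (\<Prod>t\<in>T. t a ^ \<beta> t))"
        by (rule sum.swap)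
      finally show ?thesis by (simp add: sum_distrib_right)
    qed
    also have "\<dots> = 0" by (simp add: c)
    finally show ?thesis using \<open>Q \<noteq> 0\<close> by simp
  qed
  moreover have "A \<subseteq> extensional {..<l}" by (auto simp: A_def PiE_def)
  ultimately show ?thesis using fin(1) c by (intro exI[of _ A] exI[of _ c]) simp
qed

section \<open>An upper bound for the dimension\<close>

definition dense_in :: "'i set \<Rightarrow> ('i \<Rightarrow> 'k::comm_semiring_1) set \<Rightarrow> ('i \<Rightarrow> 'k) set \<Rightarrow> bool" where
  "dense_in I Z P \<longleftrightarrow>
     P \<subseteq> Z \<and> (\<forall>f. poly_fun I f \<longrightarrow> (\<forall>a\<in>P. f a = 0) \<longrightarrow> (\<forall>a\<in>Z. f a = 0))"

lemma dense_in_zero: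
  "dense_in I Z P \<Longrightarrow> poly_fun I f \<Longrightarrow> (\<And>a. a \<in> P \<Longrightarrow> f a = 0) \<Longrightarrow> a \<in> Z \<Longrightarrow> f a = 0"
  by (auto simp: dense_in_def)

text \<open>
  This lets the later arguments pass to a dense subset whenever finitely many cases have to be
  distinguished.
\<close>

lemma dense_in_Un:
  fixes Z :: "('i \<Rightarrow> 'k::idom) set"
  assumes Z: "irreducible_closed I Z" and "dense_in I Z (A \<union> B)"
  shows "dense_in I Z A \<or> dense_in I Z B"
proof (rule ccontr)
  assume "\<not> ?thesis"
  then obtain f g where f: "poly_fun I f" "\<forall>a\<in>A. f a = 0" "\<exists>a\<in>Z. f a \<noteq> 0"
    and g: "poly_fun I g" "\<forall>a\<in>B. g a = 0" "\<exists>a\<in>Z. g a \<noteq> 0"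
    using assms(2) by (auto simp: dense_in_def)
  have "\<forall>a\<in>A \<union> B. f a * g a = 0" using f g by auto
  then have "\<forall>a\<in>Z. f a * g a = 0"
    using assms(2) poly_fun_mult[OF f(1) g(1)] unfolding dense_in_def by blast
  then show False using irreducible_closed_mult_zero[OF Z f(1) g(1)] f g by blast
qed

text \<open>
  The functions attached to a chain with more than \<open>d\<close> strict inclusions are independent on the
  largest set \<open>Z\<close> of the chain, but they satisfy a polynomial relation on the dense subset \<open>P\<close>,
  hence on \<open>Z\<close>.
\<close>

lemma variety_dim_le:
  fixes V :: "('i \<Rightarrow> 'k::alg_closed_field) set"
  assumes *: "\<And>Z. irreducible_closed I Z \<Longrightarrow> Z \<subseteq> V \<Longrightarrow>
    \<exists>P T. dense_in I Z P \<and> finite T \<and> card T \<le> d \<and> (\<forall>i\<in>I. rational_on P T (\<lambda>a. a i))"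
  shows "variety_dim I V \<le> ereal (real d)"
  unfolding variety_dim_def
proof (rule SUP_least, clarify)
  fix l and Z :: "nat \<Rightarrow> ('i \<Rightarrow> 'k) set"
  assume Z: "\<forall>i\<le>l. irreducible_closed I (Z i) \<and> Z i \<subseteq> V" and strict: "\<forall>i<l. Z i \<subset> Z (Suc i)"
  have "\<exists>f. poly_fun I f \<and> (\<forall>a\<in>Z i. f a = 0) \<and> (\<exists>a\<in>Z (Suc i). f a \<noteq> 0)" if i: "i < l" for i
  proof -
    have closed: "zariski_closed I (Z i)" "zariski_closed I (Z (Suc i))"
      using Z i by (auto simp: irreducible_closed_def)
    obtain a where "a \<in> Z (Suc i)" "a \<notin> Z i" using strict i by blast
    then show ?thesis
      using zariski_closed_separation[OF closed(1)] zariski_closed_extensional[OF closed(2)]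
      by (metis subsetD)
  qed
  then obtain f where f: "\<And>i. i < l \<Longrightarrow> poly_fun I (f i)"
    "\<And>i a. i < l \<Longrightarrow> a \<in> Z i \<Longrightarrow> f i a = 0" "\<And>i. i < l \<Longrightarrow> \<exists>a\<in>Z (Suc i). f i a \<noteq> 0"
    by metis
  show "ereal (real l) \<le> ereal (real d)"
  proof (rule ccontr)
    assume "\<not> ?thesis"
    then have "d < l" by simp
    have "irreducible_closed I (Z l)" "Z l \<subseteq> V" using Z by auto
    then obtain P T where PT: "dense_in I (Z l) P" "finite T" "card T \<le> d"
      "\<And>i. i \<in> I \<Longrightarrow> rational_on P T (\<lambda>a. a i)"
      using *[of "Z l"] by blast
    have cardT: "card T < l" using PT(3) \<open>d < l\<close> by simp
    have ratf: "rational_on P T (f i)" if "i < l" for i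
      by (rule rational_on_poly_fun[OF f(1)[OF that] PT(4)])
    obtain A where "\<exists>c. finite A \<and> A \<subseteq> extensional {..<l} \<and> (\<exists>\<alpha>\<in>A. c \<alpha> \<noteq> 0) \<and>
        (\<forall>a\<in>P. poly_at l f A c a = 0)"
      using rational_on_alg_dependent[of T l P f, OF PT(2) cardT ratf] ..
    then obtain c where c: "finite A \<and> A \<subseteq> extensional {..<l} \<and> (\<exists>\<alpha>\<in>A. c \<alpha> \<noteq> 0) \<and>
        (\<forall>a\<in>P. poly_at l f A c a = 0)" ..
    then have A: "finite A" "A \<subseteq> extensional {..<l}" "\<exists>\<alpha>\<in>A. c \<alpha> \<noteq> 0"
      and zero: "\<forall>a\<in>P. poly_at l f A c a = 0" by simp_all
    have "poly_fun I (poly_at l f A c)"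
      unfolding poly_at_def[abs_def] using f(1)
      by (intro poly_fun_sum poly_fun_mult poly_fun_const poly_fun_prod poly_fun_power) auto
    then have Zl: "poly_at l f A c a = 0" if "a \<in> Z l" for a
      using dense_in_zero[of I "Z l" P "poly_at l f A c" a] PT(1) zero that by blast
    have "\<forall>\<alpha>\<in>A. c \<alpha> = 0"
      by (rule chain_alg_independent[of l I Z f A c]) (use A Z strict f Zl in auto)
    then show False using A by blast
  qed
qed

section \<open>Matrices over a finite index set\<close>

text \<open>
  Rows and columns are indexed by subsets of an arbitrary type, and block matrices are matrices that
  vanish outside a block. A block decomposition of the index set \<open>I\<close> then needs no reindexing, and
  associativity of the product holds without conditions.
\<close>

type_synonym ('n, 'k) matrix = "'n \<Rightarrow> 'n \<Rightarrow> 'k"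

definition mmul :: "'n set \<Rightarrow> ('n, 'k::comm_ring_1) matrix \<Rightarrow> ('n, 'k) matrix \<Rightarrow> ('n, 'k) matrix" where
  "mmul U A B = (\<lambda>i j. \<Sum>k\<in>U. A i k * B k j)"

definition diag_one :: "'n set \<Rightarrow> ('n, 'k::comm_ring_1) matrix" where
  "diag_one S = (\<lambda>i j. if i = j \<and> i \<in> S then 1 else 0)"

definition supported :: "'n set \<Rightarrow> 'n set \<Rightarrow> ('n, 'k::zero) matrix \<Rightarrow> bool" where
  "supported R S A \<longleftrightarrow> (\<forall>i j. i \<notin> R \<or> j \<notin> S \<longrightarrow> A i j = 0)"

definition indep_columns :: "'n set \<Rightarrow> 'n set \<Rightarrow> ('n, 'k::comm_ring_1) matrix \<Rightarrow> bool" where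
  "indep_columns I N A \<longleftrightarrow> (\<forall>v. (\<forall>i\<in>I. (\<Sum>k\<in>N. A i k * v k) = 0) \<longrightarrow> (\<forall>k\<in>N. v k = 0))"

lemma indep_columnsD:
  assumes "indep_columns I N A" "\<And>i. i \<in> I \<Longrightarrow> (\<Sum>k\<in>N. A i k * v k) = 0" "k \<in> N"
  shows "v k = 0"
  using assms unfolding indep_columns_def by simp

lemma mmul_assoc: "mmul U (mmul V A B) C = mmul V A (mmul U B C)"
proof (intro ext)
  fix i j
  show "mmul U (mmul V A B) C i j = mmul V A (mmul U B C) i j"
    unfolding mmul_def sum_distrib_left sum_distrib_right
    by (subst sum.swap) (simp add: mult.assoc)
qed

text \<open>
  Turns an equation between products into a rewrite rule for right-nested products.
\<close>

lemma mmul_absorb: "mmul U A B = C \<Longrightarrow> mmul U A (mmul U B W) = mmul U C W"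
  by (simp flip: mmul_assoc)

lemma mmul_distrib:
  "mmul U (A + B) C = mmul U A C + mmul U B C" "mmul U A (B + C) = mmul U A B + mmul U A C"
  "mmul U (A - B) C = mmul U A C - mmul U B C" "mmul U A (B - C) = mmul U A B - mmul U A C"
  by (auto simp: mmul_def fun_eq_iff distrib_left distrib_right left_diff_distrib
      right_diff_distrib sum.distrib sum_subtractf)

lemma mmul_zero [simp]: "mmul U 0 A = 0" "mmul U A 0 = 0"
  by (auto simp: mmul_def fun_eq_iff)

lemma mmul_diag_one:
  assumes "finite U" "S \<subseteq> U"
  shows "mmul U (diag_one S) A = (\<lambda>i j. if i \<in> S then A i j else 0)"
    and "mmul U A (diag_one S) = (\<lambda>i j. if j \<in> S then A i j else 0)"
proof -
  have "(\<Sum>k\<in>U. (if i = k \<and> i \<in> S then 1 else 0) * A k j) = (\<Sum>k\<in>U. if k = i then (if i \<in> S then A i j else 0) else 0)" for i j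
    by (intro sum.cong) auto
  then show "mmul U (diag_one S) A = (\<lambda>i j. if i \<in> S then A i j else 0)"
    using assms by (auto simp: mmul_def diag_one_def fun_eq_iff)
  have "(\<Sum>k\<in>U. A i k * (if k = j \<and> k \<in> S then 1 else 0)) = (\<Sum>k\<in>U. if k = j then (if j \<in> S then A i j else 0) else 0)" for i j
    by (intro sum.cong) auto
  then show "mmul U A (diag_one S) = (\<lambda>i j. if j \<in> S then A i j else 0)"
    using assms by (auto simp: mmul_def diag_one_def fun_eq_iff)
qed

lemma mmul_diag_one_supported:
  assumes "finite U" "S \<subseteq> U"
  shows "supported S S' A \<Longrightarrow> mmul U (diag_one S) A = A"
    and "supported S' S A \<Longrightarrow> mmul U A (diag_one S) = A"
  by (auto simp: mmul_diag_one[OF assms] supported_def fun_eq_iff)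

lemma supported_mmul: "supported R S A \<Longrightarrow> supported R' S' B \<Longrightarrow> supported R S' (mmul U A B)"
  by (auto simp: supported_def mmul_def)

lemma mmul_shrink:
  assumes "finite U" "S \<subseteq> U" "supported R S A"
  shows "mmul U A B = mmul S A B"
  unfolding mmul_def using assms
  by (intro ext sum.mono_neutral_right) (auto simp: supported_def)

lemma trace_mmul_commute: "(\<Sum>i\<in>U. mmul U A B i i) = (\<Sum>i\<in>U. mmul U B A i i)"
  unfolding mmul_def by (subst sum.swap) (simp add: mult.commute)

text \<open>
  A maximal independent set \<open>N\<close> of columns spans the others, and \<open>H\<close> holds the coefficients.
\<close>

lemma column_basis:
  fixes A :: "('n, 'k::field) matrix"
  assumes "finite I"
  shows "\<exists>N\<subseteq>I. \<exists>H. indep_columns I N A \<and> supported N (I - N) H \<and>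
    (\<forall>i\<in>I. \<forall>j\<in>I - N. A i j = (\<Sum>k\<in>N. A i k * H k j))"
proof -
  let ?F = "{N. N \<subseteq> I \<and> indep_columns I N A}"
  have "finite ?F" using assms by simp
  moreover have "{} \<in> ?F" by (simp add: indep_columns_def)
  ultimately obtain N where N: "N \<in> ?F" and max: "\<forall>N'\<in>?F. N \<subseteq> N' \<longrightarrow> N = N'"
    using finite_has_maximal2[of ?F "{}"] by blast
  have fN: "finite N" using N assms finite_subset by auto
  have "\<exists>h. \<forall>i\<in>I. A i j = (\<Sum>k\<in>N. A i k * h k)" if j: "j \<in> I - N" for j
  proof -
    have "insert j N \<notin> ?F" using max j by blast
    then obtain v where v: "\<forall>i\<in>I. (\<Sum>k\<in>insert j N. A i k * v k) = 0" "\<exists>k\<in>insert j N. v k \<noteq> 0"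
      using N j by (auto simp: indep_columns_def)
    have sum0: "A i j * v j + (\<Sum>k\<in>N. A i k * v k) = 0" if "i \<in> I" for i
      using v(1) that j fN by simp
    have "v j \<noteq> 0"
    proof
      assume "v j = 0"
      with sum0 N have "\<forall>k\<in>N. v k = 0" using indep_columnsD[of I N A v] by simp
      with v(2) \<open>v j = 0\<close> show False by blast
    qed
    have "A i j = (\<Sum>k\<in>N. A i k * (- v k / v j))" if "i \<in> I" for i
    proof -
      have e1: "(\<Sum>k\<in>N. A i k * (- v k / v j)) = - (\<Sum>k\<in>N. A i k * v k) / v j"
        by (simp add: sum_negf sum_divide_distrib)
      have "A i j * v j = - (\<Sum>k\<in>N. A i k * v k)"
        using sum0[OF that] by (rule eq_neg_iff_add_eq_0[THEN iffD2])
      then have e2: "A i j = - (\<Sum>k\<in>N. A i k * v k) / v j"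
        by (rule nonzero_eq_divide_eq[OF \<open>v j \<noteq> 0\<close>, THEN iffD2])
      show ?thesis unfolding e1 by (rule e2)
    qed
    then show ?thesis by (intro exI[of _ "\<lambda>k. - v k / v j"] ballI)
  qed
  then have "\<forall>j\<in>I - N. \<exists>h. \<forall>i\<in>I. A i j = (\<Sum>k\<in>N. A i k * h k)" by (intro ballI)
  then have "\<exists>h. \<forall>j\<in>I - N. \<forall>i\<in>I. A i j = (\<Sum>k\<in>N. A i k * h j k)"
    by (rule bchoice)
  then obtain h where h: "\<forall>j\<in>I - N. \<forall>i\<in>I. A i j = (\<Sum>k\<in>N. A i k * h j k)" ..
  let ?H = "\<lambda>k j. if k \<in> N \<and> j \<in> I - N then h j k else 0"
  have "\<forall>i\<in>I. \<forall>j\<in>I - N. A i j = (\<Sum>k\<in>N. A i k * ?H k j)"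
  proof (intro ballI)
    fix i j assume "i \<in> I" "j \<in> I - N"
    then show "A i j = (\<Sum>k\<in>N. A i k * ?H k j)" using h by simp
  qed
  moreover have "supported N (I - N) ?H" by (auto simp: supported_def)
  ultimately show ?thesis using N by (intro exI[of _ N] exI[of _ ?H] conjI) simp_all
qed

text \<open>
  For each unit vector, the columns together with it are one more than the number of rows, so they
  satisfy a linear relation, in which the unit vector must occur.
\<close>

lemma right_inverse_exists:
  fixes A :: "('n, 'k::field) matrix"
  assumes "finite I" and supp: "supported I I A" and indep: "indep_columns I I A"
  shows "\<exists>W. supported I I W \<and> mmul I A W = diag_one I"
proof -
  have "\<exists>w. \<forall>i\<in>I. (\<Sum>k\<in>I. A i k * w k) = (if i = j then 1 else 0)" if j: "j \<in> I" for j
  proof -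
    let ?m = "\<lambda>x b. case x of None \<Rightarrow> if b = j then 1 else 0 | Some k \<Rightarrow> A b k"
    have "card I < card (insert None (Some ` I))"
      using assms(1) by (simp add: card_image)
    then obtain c where nz: "\<exists>x\<in>insert None (Some ` I). c x \<noteq> 0"
      and c: "\<forall>b\<in>I. (\<Sum>x\<in>insert None (Some ` I). c x * ?m x b) = 0"
      using nontrivial_solution[of I "insert None (Some ` I)" ?m] assms(1) by auto
    have sum0: "c None * (if b = j then 1 else 0) + (\<Sum>k\<in>I. A b k * c (Some k)) = 0" if "b \<in> I" for b
    proof -
      have "(\<Sum>x\<in>insert None (Some ` I). c x * ?m x b) =
          c None * (if b = j then 1 else 0) + (\<Sum>x\<in>Some ` I. c x * ?m x b)"
        using assms(1) by (subst sum.insert) auto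
      also have "(\<Sum>x\<in>Some ` I. c x * ?m x b) = (\<Sum>k\<in>I. A b k * c (Some k))"
        by (subst sum.reindex) (simp_all add: mult.commute)
      finally show ?thesis using c that by simp
    qed
    have "c None \<noteq> 0"
    proof
      assume 0: "c None = 0"
      with sum0 have "\<forall>b\<in>I. (\<Sum>k\<in>I. A b k * c (Some k)) = 0" by simp
      then have "\<forall>k\<in>I. c (Some k) = 0"
        using indep_columnsD[OF indep, of "\<lambda>k. c (Some k)"] by blast
      with 0 nz show False by auto
    qed
    have "(\<Sum>k\<in>I. A b k * (- c (Some k) / c None)) = (if b = j then 1 else 0)" if "b \<in> I" for b
    proof -
      have "(\<Sum>k\<in>I. A b k * (- c (Some k) / c None)) = - (\<Sum>k\<in>I. A b k * c (Some k)) / c None"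
        by (simp add: sum_negf sum_divide_distrib)
      also have "\<dots> = (if b = j then 1 else 0)"
        
        using sum0[OF that] \<open>c None \<noteq> 0\<close> by (auto simp: add_eq_0_iff)
      finally show ?thesis .
    qed
    then show ?thesis by (intro exI[of _ "\<lambda>k. - c (Some k) / c None"] ballI)
  qed
  then have "\<forall>j\<in>I. \<exists>w. \<forall>i\<in>I. (\<Sum>k\<in>I. A i k * w k) = (if i = j then 1 else 0)"
    by (intro ballI)
  then have "\<exists>w. \<forall>j\<in>I. \<forall>i\<in>I. (\<Sum>k\<in>I. A i k * w j k) = (if i = j then 1 else 0)"
    by (rule bchoice)
  then obtain w where w: "\<forall>j\<in>I. \<forall>i\<in>I. (\<Sum>k\<in>I. A i k * w j k) = (if i = j then 1 else 0)" ..
  let ?W = "\<lambda>k j. if k \<in> I \<and> j \<in> I then w j k else 0"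
  have "mmul I A ?W i j = diag_one I i j" for i j
  proof (cases "i \<in> I \<and> j \<in> I")
    case True
    then have "mmul I A ?W i j = (\<Sum>k\<in>I. A i k * w j k)" by (simp add: mmul_def)
    then show ?thesis using w True by (auto simp: diag_one_def)
  qed (use supp in \<open>auto simp: mmul_def diag_one_def supported_def\<close>)
  moreover have "supported I I ?W" by (auto simp: supported_def)
  ultimately show ?thesis by (intro exI[of _ ?W] conjI ext)
qed

lemma indep_columns_cancel:
  assumes "finite I" "N \<subseteq> I" "indep_columns I N A" "supported N S V" "mmul I A V = 0"
  shows "V = 0"
proof (intro ext)
  fix k j
  have "(\<Sum>k\<in>N. A i k * V k j) = 0" for i
  proof -
    have "(\<Sum>k\<in>N. A i k * V k j) = mmul I A V i j"
      unfolding mmul_def using assms by (intro sum.mono_neutral_left) (auto simp: supported_def)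
    then show ?thesis using assms(5) by simp
  qed
  then have "k \<in> N \<Longrightarrow> V k j = 0" using indep_columnsD[OF assms(3), of "\<lambda>k. V k j"] by blast
  then show "V k j = 0 k j" using assms(4) by (cases "k \<in> N") (auto simp: supported_def)
qed

text \<open>
  An inverse \<open>W\<close> of \<open>Y\<close> would give \<open>W X = X W + 1\<close>. Comparing traces makes the size of the matrices
  zero in the field, and the field has characteristic zero.
\<close>

lemma jordan_pair_singular:
  fixes X Y :: "('n, 'k::field_char_0) matrix"
  assumes "finite I" and supp: "supported I I X" "supported I I Y"
    and rel: "mmul I X Y = mmul I Y X + mmul I Y Y" and indep: "indep_columns I I Y"
  shows "I = {}"
proof -
  let ?e = "diag_one I :: ('n, 'k) matrix"
  obtain W where W: "supported I I W" and YW: "mmul I Y W = ?e"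
    using right_inverse_exists[OF assms(1) supp(2) indep] by blast
  note e = mmul_diag_one_supported[OF assms(1) subset_refl]
  have "mmul I Y (mmul I W Y - ?e) = 0"
    by (simp add: mmul_distrib mmul_absorb[OF YW] e[OF supp(2)])
  moreover have "supported I I (mmul I W Y - ?e)"
    using supported_mmul[OF W supp(2), of I] by (auto simp: supported_def diag_one_def)
  ultimately have "mmul I W Y - ?e = 0"
    using indep_columns_cancel[OF assms(1) subset_refl indep] by blast
  then have WY: "mmul I W Y = ?e" by simp
  have "mmul I W X = mmul I (mmul I W (mmul I X Y)) W"
    by (simp add: mmul_assoc YW e[OF supp(1)])
  also have "\<dots> = mmul I X W + ?e"
    unfolding rel mmul_distrib
    by (simp add: mmul_absorb[OF WY] e[OF supp(1)] e[OF supp(2)] mmul_distrib YW)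
  finally have "(\<Sum>i\<in>I. mmul I W X i i) = (\<Sum>i\<in>I. mmul I X W i i) + (\<Sum>i\<in>I. ?e i i)"
    by (simp add: sum.distrib)
  then have "(\<Sum>i\<in>I. ?e i i) = 0" using trace_mmul_commute[of I W X] by simp
  moreover have "(\<Sum>i\<in>I. ?e i i) = of_nat (card I)" by (simp add: diag_one_def)
  ultimately show ?thesis using assms(1) by simp
qed

lemma supported_diff_add:
  "supported R S A \<Longrightarrow> supported R S B \<Longrightarrow> supported R S (A + B)"
  "supported R S A \<Longrightarrow> supported R S B \<Longrightarrow> supported R S (A - B)"
  for A :: "('n, 'k::ab_group_add) matrix"
  by (auto simp: supported_def)

lemma supported_diag_one: "supported S S (diag_one S)"
  by (auto simp: supported_def diag_one_def)

section \<open>Splitting off the kernel of \<open>Y\<close>\<close>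

text \<open>
  The columns of \<open>Y\<close> with index in \<open>N\<close> form a basis of its column space, and \<open>H\<close> expresses the other
  columns by them. Hence the kernel of \<open>Y\<close> has as basis the vectors \<open>e\<^sub>j - \<Sum>\<^sub>k H k j e\<^sub>k\<close> for
  \<open>j \<in> I - N\<close>, and the \<open>e\<^sub>k\<close> with \<open>k \<in> N\<close> complete it to a basis of the whole space.
\<close>

locale jordan_splitting =
  fixes I N :: "'n set" and X Y H :: "('n, 'k::field) matrix"
  assumes fin: "finite I" and N: "N \<subseteq> I"
    and suppX: "supported I I X" and suppY: "supported I I Y"
    and suppH: "supported N (I - N) H"
    and jordan: "mmul I X Y = mmul I Y X + mmul I Y Y"
    and indep: "indep_columns I N Y"
    and span: "\<forall>i\<in>I. \<forall>j\<in>I - N. Y i j = (\<Sum>k\<in>N. Y i k * H k j)"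
begin

abbreviation times_I (infixl "\<star>" 70) where "A \<star> B \<equiv> mmul I A B"
abbreviation "J \<equiv> I - N"
abbreviation "eN \<equiv> diag_one N :: ('n, 'k) matrix"
abbreviation "eJ \<equiv> diag_one (I - N) :: ('n, 'k) matrix"

text \<open>
  \<open>proj\<close> is the projection onto the span of the \<open>e\<^sub>k\<close>, \<open>k \<in> N\<close>, along the kernel of \<open>Y\<close>. In the basis
  above, \<open>quot A\<close> is the lower right block of \<open>A\<close>, which is the induced matrix on the quotient by the
  kernel if \<open>A\<close> preserves the kernel: \<open>quot X\<close> and
  \<open>quot Y\<close> are the lower right blocks \<open>D\<close> and \<open>E\<close> of \<open>X\<close> and \<open>Y\<close>. The upper right block \<open>C\<close> of
  \<open>Y\<close> is \<open>corner\<close>, and \<open>upper\<close> is the pair of upper blocks \<open>(A B)\<close> of \<open>X\<close>.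
\<close>

definition "proj = eN + H"
definition "quot A = proj \<star> A \<star> eN"
definition "corner = eJ \<star> Y \<star> eN"
definition "upper = eJ \<star> X \<star> (eJ - H) + eJ \<star> X \<star> eN"

lemma subsets: "J \<subseteq> I" by blast

lemma eN_eJ: "eN \<star> eN = eN" "eJ \<star> eJ = eJ" "eN \<star> eJ = 0" "eJ \<star> eN = 0"
  unfolding mmul_diag_one(1)[OF fin N] mmul_diag_one(1)[OF fin subsets]
  by (auto simp: diag_one_def fun_eq_iff)

lemma diag_one_split: "diag_one I = eJ + eN"
  using N by (auto simp: diag_one_def fun_eq_iff)

lemma H_absorb: "eN \<star> H = H" "H \<star> eJ = H" "eJ \<star> H = 0" "H \<star> eN = 0"
  using suppH
  by (auto simp: mmul_diag_one[OF fin N] mmul_diag_one[OF fin subsets] supported_def fun_eq_iff)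

lemma split_left: "supported I S A \<Longrightarrow> eJ \<star> A + eN \<star> A = A"
  and split_right: "supported S I A \<Longrightarrow> A \<star> eJ + A \<star> eN = A"
  by (auto simp: mmul_diag_one[OF fin N] mmul_diag_one[OF fin subsets] supported_def fun_eq_iff)

lemma Y_H: "Y \<star> H = Y \<star> eJ"
proof (intro ext)
  fix i j
  have "(Y \<star> H) i j = (\<Sum>k\<in>N. Y i k * H k j)"
    unfolding mmul_def using fin N suppH
    by (intro sum.mono_neutral_right) (auto simp: supported_def)
  also have "\<dots> = (if j \<in> J then Y i j else 0)"
  proof (cases "j \<in> J \<and> i \<in> I")
    case True
    then show ?thesis using span by simp
  next
    case False
    then show ?thesis using suppY suppH by (auto simp: supported_def intro!: sum.neutral)
  qed
  finally show "(Y \<star> H) i j = (Y \<star> eJ) i j" by (simp add: mmul_diag_one[OF fin subsets])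
qed

text \<open>
  The complementary projection \<open>1 - proj\<close> has its image in the kernel of \<open>Y\<close>.
\<close>

lemma Y_proj: "Y \<star> proj = Y"
  using split_right[OF suppY] by (simp add: proj_def mmul_distrib Y_H add.commute)

lemma proj_eN: "proj \<star> eN = eN" and eN_proj: "eN \<star> proj = proj" and eJ_proj: "eJ \<star> proj = 0"
  by (simp_all add: proj_def mmul_distrib eN_eJ H_absorb)

lemma supp_proj: "supported N I proj"
  using suppH N by (auto simp: proj_def supported_def diag_one_def)

text \<open>
  The kernel of \<open>Y\<close>, which is also the kernel of \<open>proj\<close>, is invariant under \<open>X\<close>: for \<open>V = X (1 - proj)\<close>
  one has \<open>Y V = (X Y - Y Y) (1 - proj) = 0\<close>, and \<open>Y V = Y proj V\<close> together with the independence of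
  the columns in \<open>N\<close> gives \<open>proj V = 0\<close>.
\<close>

lemma proj_X: "proj \<star> (X \<star> proj) = proj \<star> X"
proof -
  define V where "V = X - X \<star> proj"
  have YX: "Y \<star> X = X \<star> Y - Y \<star> Y" by (simp add: jordan)
  have "Y \<star> (proj \<star> V) = Y \<star> X - Y \<star> X \<star> proj"
    by (simp add: mmul_absorb[OF Y_proj] V_def mmul_distrib mmul_assoc)
  also have "Y \<star> X \<star> proj = Y \<star> X"
    unfolding YX by (simp add: mmul_distrib mmul_assoc Y_proj)
  also have "Y \<star> X - Y \<star> X = 0" by simp
  finally have "Y \<star> (proj \<star> V) = 0" .
  moreover have "supported I I V"
    unfolding V_def using suppX supp_proj N
    by (intro supported_diff_add supported_mmul[of I I X N]) auto
  then have "supported N I (proj \<star> V)" by (rule supported_mmul[OF supp_proj])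
  ultimately have "proj \<star> V = 0" using indep_columns_cancel[OF fin N indep] by blast
  then show ?thesis by (simp add: V_def mmul_distrib)
qed

lemmas absorb = eN_eJ H_absorb Y_proj proj_eN eN_proj eJ_proj

lemma quot_proj: "quot X \<star> proj = proj \<star> X" "quot Y \<star> proj = proj \<star> Y"
  by (simp_all add: quot_def mmul_assoc eN_proj proj_X Y_proj)

lemma supp_quot: "supported N N (quot A)"
  using supp_proj unfolding quot_def mmul_diag_one(2)[OF fin N]
  by (auto simp: supported_def mmul_def)

lemma supp_corner: "supported J N corner"
  unfolding corner_def mmul_diag_one(2)[OF fin N] mmul_diag_one(1)[OF fin subsets]
  by (auto simp: supported_def)

lemma supp_upper: "supported J I upper"
proof -
  have "supported J I (eJ \<star> X \<star> A)" if "supported I I A" for A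
    by (rule supported_mmul[OF supported_mmul[OF supported_diag_one suppX] that])
  moreover have "supported I I eN" "supported I I (eJ - H)"
    using suppH N by (auto simp: supported_def diag_one_def)
  ultimately show ?thesis unfolding upper_def by (intro supported_diff_add(1))
qed

lemma eN_quot: "eN \<star> quot A = quot A"
  by (simp add: quot_def mmul_assoc mmul_absorb[OF eN_proj])

lemma quot_mult: "quot A \<star> quot B = quot A \<star> (proj \<star> (B \<star> eN))"
  by (simp add: quot_def mmul_assoc)

text \<open>
  Both \<open>X\<close> and \<open>Y\<close> preserve the kernel of \<open>Y\<close>, so the relation between them passes to the quotient.
\<close>

lemma quot_jordan: "mmul N (quot X) (quot Y) = mmul N (quot Y) (quot X) + mmul N (quot Y) (quot Y)"
proof -
  have "quot X \<star> quot Y = proj \<star> (X \<star> Y) \<star> eN"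
    by (simp add: quot_mult mmul_absorb[OF quot_proj(1)] mmul_assoc)
  moreover have "quot Y \<star> quot A = proj \<star> (Y \<star> A) \<star> eN" for A
    by (simp add: quot_mult mmul_absorb[OF quot_proj(2)] mmul_assoc)
  ultimately have "quot X \<star> quot Y = quot Y \<star> quot X + quot Y \<star> quot Y"
    by (simp add: jordan mmul_distrib)
  then show ?thesis by (simp only: mmul_shrink[OF fin N supp_quot])
qed

text \<open>
  The upper right block of the relation, \<open>A C + B E = C D + C E\<close>.
\<close>

lemma upper_equation: "upper \<star> (corner + quot Y) = corner \<star> (quot X + quot Y)"
proof -
  have "eJ \<star> quot Y = 0" "H \<star> quot Y = 0"
    using mmul_absorb[OF eN_eJ(4), of "quot Y"] mmul_absorb[OF H_absorb(4), of "quot Y"]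
    by (simp_all add: eN_quot)
  moreover have "eN \<star> (eJ \<star> (Y \<star> eN)) = 0" by (simp add: mmul_absorb[OF eN_eJ(3)])
  moreover have "eN \<star> quot Y = proj \<star> (Y \<star> eN)"
    unfolding eN_quot by (simp add: quot_def mmul_assoc)
  ultimately have "upper \<star> (corner + quot Y) =
      eJ \<star> (X \<star> (((eJ - H) + proj) \<star> (Y \<star> eN)))"
    unfolding upper_def corner_def
    by (simp add: mmul_assoc mmul_distrib mmul_absorb[OF eN_eJ(2)] mmul_absorb[OF H_absorb(2)])
  also have "\<dots> = eJ \<star> (X \<star> Y \<star> eN)"
  proof -
    have "(eJ - H) + proj = diag_one I" by (simp add: proj_def diag_one_split)
    moreover have "diag_one I \<star> (Y \<star> eN) = Y \<star> eN"
      using mmul_diag_one_supported(1)[OF fin subset_refl suppY] by (simp flip: mmul_assoc)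
    ultimately show ?thesis by (simp add: mmul_assoc)
  qed
  also have "\<dots> = corner \<star> (quot X + quot Y)"
    by (simp add: jordan corner_def quot_def mmul_assoc mmul_distrib mmul_absorb[OF eN_proj]
        mmul_absorb[OF Y_proj])
  finally show ?thesis .
qed

text \<open>
  The matrix \<open>(C; E)\<close> consists of the columns of \<open>Y\<close> in \<open>N\<close> after an invertible change of
  coordinates on the rows, which adds \<open>H\<close> times the rows in \<open>J\<close> to the rows in \<open>N\<close>.
\<close>

lemma indep_corner_quot: "indep_columns I N (corner + quot Y)"
  unfolding indep_columns_def
proof (intro allI impI)
  fix v assume v: "\<forall>i\<in>I. (\<Sum>k\<in>N. (corner + quot Y) i k * v k) = 0"
  have corner: "corner i k = (if i \<in> J then Y i k else 0)" if "k \<in> N" for i k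
    using that by (simp add: corner_def mmul_diag_one[OF fin N] mmul_diag_one[OF fin subsets])
  have quot: "quot Y i k = (if i \<in> N then Y i k else 0) + (\<Sum>l\<in>I. H i l * Y l k)" if "k \<in> N" for i k
    using that by (simp add: quot_def proj_def mmul_distrib mmul_diag_one[OF fin N])
      (simp add: mmul_def)
  have J: "(\<Sum>k\<in>N. Y i k * v k) = 0" if i: "i \<in> J" for i
  proof -
    have "(\<Sum>k\<in>N. (corner + quot Y) i k * v k) = (\<Sum>k\<in>N. Y i k * v k)"
      using i suppH by (intro sum.cong refl) (auto simp: corner quot supported_def)
    then show ?thesis using v i by simp
  qed
  have "(\<Sum>k\<in>N. Y i k * v k) = 0" if i: "i \<in> N" for i
  proof -
    have "(\<Sum>k\<in>N. (corner + quot Y) i k * v k) =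
        (\<Sum>k\<in>N. Y i k * v k) + (\<Sum>k\<in>N. \<Sum>l\<in>I. H i l * (Y l k * v k))"
      unfolding sum.distrib[symmetric] using i
      by (intro sum.cong refl) (auto simp: corner quot distrib_right sum_distrib_right mult.assoc)
    also have "(\<Sum>k\<in>N. \<Sum>l\<in>I. H i l * (Y l k * v k)) = (\<Sum>l\<in>I. H i l * (\<Sum>k\<in>N. Y l k * v k))"
      by (subst sum.swap) (simp add: sum_distrib_left)
    also have "\<dots> = 0"
    proof (rule sum.neutral, rule ballI)
      fix l show "H i l * (\<Sum>k\<in>N. Y l k * v k) = 0"
        using J suppH by (cases "l \<in> J") (auto simp: supported_def)
    qed
    finally show ?thesis using v i N by auto
  qed
  with J have "(\<Sum>k\<in>N. Y i k * v k) = 0" if "i \<in> I" for i using that by blast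
  then show "\<forall>k\<in>N. v k = 0" using indep_columnsD[OF indep] by blast
qed

text \<open>
  The rows of \<open>Y\<close> in \<open>J\<close> are \<open>C proj\<close>, and those in \<open>N\<close> arise from \<open>E proj = proj Y\<close> by subtracting
  \<open>H\<close> times the rows in \<open>J\<close>. The same recovers \<open>X\<close>, whose rows in \<open>J\<close> are \<open>A + B proj\<close>.
\<close>

lemma reconstruct_Y: "Y = corner \<star> proj + quot Y \<star> proj - H \<star> (corner \<star> proj)"
proof -
  have "corner \<star> proj = eJ \<star> Y" by (simp add: corner_def mmul_assoc eN_proj Y_proj)
  moreover have "quot Y \<star> proj = eN \<star> Y + H \<star> (eJ \<star> Y)"
    unfolding quot_proj by (simp add: proj_def mmul_distrib mmul_absorb[OF H_absorb(2)])
  ultimately show ?thesis using split_left[OF suppY] by simp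
qed

lemma reconstruct_X:
  "X = (upper \<star> eJ + upper \<star> eN \<star> proj) + quot X \<star> proj - H \<star> (upper \<star> eJ + upper \<star> eN \<star> proj)"
proof -
  have "upper \<star> eJ = eJ \<star> X \<star> (eJ - H)" "upper \<star> eN = eJ \<star> X \<star> eN"
    by (simp_all add: upper_def mmul_distrib mmul_assoc absorb)
  then have "upper \<star> eJ + upper \<star> eN \<star> proj = eJ \<star> (X \<star> ((eJ - H) + proj))"
    by (simp add: mmul_assoc eN_proj mmul_distrib)
  moreover have "(eJ - H) + proj = diag_one I" by (simp add: proj_def diag_one_split)
  moreover have "X \<star> diag_one I = X"
    by (rule mmul_diag_one_supported(2)[OF fin subset_refl suppX])
  ultimately have "upper \<star> eJ + upper \<star> eN \<star> proj = eJ \<star> X" by (simp only:)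
  moreover have "quot X \<star> proj = eN \<star> X + H \<star> (eJ \<star> X)"
    unfolding quot_proj by (simp add: proj_def mmul_distrib mmul_absorb[OF H_absorb(2)])
  ultimately show ?thesis using split_left[OF suppX] by simp
qed

end

section \<open>Elimination on large sets\<close>

text \<open>
  The members of such a family are thought of as large sets. The family used below consists of the
  dense subsets of an irreducible closed set.
\<close>

definition partition_regular :: "('a set \<Rightarrow> bool) \<Rightarrow> bool" where
  "partition_regular L \<longleftrightarrow> \<not> L {} \<and> (\<forall>A B. L (A \<union> B) \<longrightarrow> L A \<or> L B)"

lemma partition_regular_pigeonhole:
  assumes L: "partition_regular L" and "finite V" "L P" "\<forall>a\<in>P. c a \<in> V"
  shows "\<exists>v\<in>V. L {a \<in> P. c a = v}"
  using assms(2-4)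
proof (induction V arbitrary: P rule: finite_induct)
  case empty
  then have "P = {}" by auto
  then show ?case using L empty by (simp add: partition_regular_def)
next
  case (insert v V)
  have "P = {a \<in> P. c a = v} \<union> {a \<in> P. c a \<noteq> v}" by blast
  then have "L {a \<in> P. c a = v} \<or> L {a \<in> P. c a \<noteq> v}"
    using L insert.prems(1) unfolding partition_regular_def by metis
  then show ?case
  proof
    assume "L {a \<in> P. c a \<noteq> v}"
    then have "\<exists>u\<in>V. L {a \<in> {a \<in> P. c a \<noteq> v}. c a = u}"
      using insert.prems(2) by (intro insert.IH) auto
    then obtain u where "u \<in> V" "L {a \<in> {a \<in> P. c a \<noteq> v}. c a = u}" ..
    moreover from this have "{a \<in> {a \<in> P. c a \<noteq> v}. c a = u} = {a \<in> P. c a = u}"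
      using insert.hyps by auto
    ultimately show ?thesis by auto
  qed auto
qed

text \<open>
  One step of Gaussian elimination with pivot \<open>A i0 k\<close>: the coefficient of column \<open>k\<close> in a relation
  between the old columns can be chosen so that the relation also holds in row \<open>i0\<close>.
\<close>

lemma indep_columns_eliminate:
  fixes A :: "('n, 'k::field) matrix"
  assumes "finite N" "k \<notin> N" and indep: "indep_columns I (insert k N) A" and i0: "A i0 k \<noteq> 0"
  shows "indep_columns (I - {i0}) N (\<lambda>i k'. A i k' - A i k * (A i0 k' / A i0 k))"
  unfolding indep_columns_def
proof (intro allI impI)
  fix v assume v: "\<forall>i\<in>I - {i0}. (\<Sum>k'\<in>N. (A i k' - A i k * (A i0 k' / A i0 k)) * v k') = 0"
  define u where "u = v(k := - (\<Sum>k'\<in>N. (A i0 k' / A i0 k) * v k'))"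
  have "(\<Sum>k'\<in>insert k N. A i k' * u k') = 0" if "i \<in> I" for i
  proof -
    have "(\<Sum>k'\<in>insert k N. A i k' * u k') = A i k * u k + (\<Sum>k'\<in>N. A i k' * v k')"
      using assms(1,2) by (auto simp: u_def intro!: sum.cong)
    also have "\<dots> = (\<Sum>k'\<in>N. (A i k' - A i k * (A i0 k' / A i0 k)) * v k')"
      by (simp add: u_def left_diff_distrib sum_subtractf sum_distrib_left mult.assoc)
    also have "\<dots> = 0" using v that i0 by (cases "i = i0") auto
    finally show ?thesis .
  qed
  then have "\<forall>k'\<in>insert k N. u k' = 0" using indep_columnsD[OF indep, of u] by simp
  then show "\<forall>k'\<in>N. v k' = 0" using assms(2) by (auto simp: u_def split: if_splits)
qed

text \<open>
  For each \<open>j \<in> J\<close>, the row \<open>z j\<close> solves a linear system \<open>z j M = w j\<close> with independent columns. Each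
  equation expresses one unknown rationally by the others, with the same pivots for all \<open>j\<close>, because
  they depend only on \<open>M\<close>. The unknowns outside the set \<open>R\<close> of pivots remain as parameters. The
  position of a nonzero pivot depends on the point, but it is constant on a large subset.
\<close>

lemma eliminate_unknowns:
  fixes z :: "'j \<Rightarrow> 'n \<Rightarrow> 'a \<Rightarrow> 'k::field" and M :: "'n \<Rightarrow> 'n \<Rightarrow> 'a \<Rightarrow> 'k"
  assumes L: "partition_regular L" and "finite N" "finite I" "L P"
    and "\<forall>a\<in>P. indep_columns I N (\<lambda>i k. M i k a)"
    and "\<forall>a\<in>P. \<forall>j\<in>J. \<forall>k\<in>N. (\<Sum>i\<in>I. z j i a * M i k a) = w j k a"
    and "\<forall>k\<in>N. \<forall>i\<in>I. rational_on P T (M i k)"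
    and "\<forall>k\<in>N. \<forall>j\<in>J. rational_on P T (w j k)"
  shows "\<exists>P' R. P' \<subseteq> P \<and> L P' \<and> R \<subseteq> I \<and> card R = card N \<and>
    (\<forall>j\<in>J. \<forall>i\<in>I. rational_on P' (T \<union> {z j i | j i. j \<in> J \<and> i \<in> I - R}) (z j i))"
  using assms(2-8)
proof (induction N arbitrary: I P M w rule: finite_induct)
  case empty
  show ?case
    using empty(2) by (intro exI[of _ P] exI[of _ "{}"]) (auto intro!: rational_on.base)
next
  case (insert k N)
  have "\<exists>i\<in>I. M i k a \<noteq> 0" if a: "a \<in> P" for a
  proof (rule ccontr)
    assume *: "\<not> ?thesis"
    let ?v = "\<lambda>k'. if k' = k then 1 else 0 :: 'k"
    have "indep_columns I (insert k N) (\<lambda>i k. M i k a)" using insert.prems(3) a by blast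
    moreover have "(\<Sum>k'\<in>insert k N. M i k' a * ?v k') = 0" if "i \<in> I" for i
      using * that insert.hyps by (subst sum.insert) (auto intro!: sum.neutral)
    ultimately have "?v k = 0"
      using indep_columnsD[of I "insert k N" "\<lambda>i k. M i k a" ?v k] by blast
    then show False by simp
  qed
  then have "\<forall>a\<in>P. \<exists>i. i \<in> I \<and> M i k a \<noteq> 0" by blast
  then have "\<exists>p. \<forall>a\<in>P. p a \<in> I \<and> M (p a) k a \<noteq> 0" by (rule bchoice)
  then obtain p where p: "\<forall>a\<in>P. p a \<in> I \<and> M (p a) k a \<noteq> 0" ..
  then have "\<exists>i0\<in>I. L {a \<in> P. p a = i0}"
    using insert.prems by (intro partition_regular_pigeonhole[OF L]) auto
  then obtain i0 where i0: "i0 \<in> I" "L {a \<in> P. p a = i0}" ..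
  define P1 where "P1 = {a \<in> P. p a = i0}"
  have P1: "P1 \<subseteq> P" "L P1" and pivot: "\<And>a. a \<in> P1 \<Longrightarrow> M i0 k a \<noteq> 0"
    using i0 p by (auto simp: P1_def)
  define I' where "I' = I - {i0}"
  define q where "q k' a = M i0 k' a / M i0 k a" for k' a
  define M' where "M' i k' a = M i k' a - M i k a * q k' a" for i k' a
  define w' where "w' j k' a = w j k' a - w j k a * q k' a" for j k' a
  have ratM: "rational_on P1 T (M i k')" if "i \<in> I" "k' \<in> insert k N" for i k'
    using insert.prems(5) that P1(1) by (blast intro: rational_on_mono)
  have ratw: "rational_on P1 T (w j k')" if "j \<in> J" "k' \<in> insert k N" for j k'
    using insert.prems(6) that P1(1) by (blast intro: rational_on_mono)
  have ratq: "rational_on P1 T (q k')" if "k' \<in> N" for k'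
    unfolding q_def[abs_def] using that i0 pivot by (intro rational_on_divide ratM) auto
  have "\<exists>P' R. P' \<subseteq> P1 \<and> L P' \<and> R \<subseteq> I' \<and> card R = card N \<and>
    (\<forall>j\<in>J. \<forall>i\<in>I'. rational_on P' (T \<union> {z j i | j i. j \<in> J \<and> i \<in> I' - R}) (z j i))"
  proof (rule insert.IH[of I' P1 M' w'])
    show "finite I'" using insert.prems by (simp add: I'_def)
    show "\<forall>a\<in>P1. indep_columns I' N (\<lambda>i k. M' i k a)"
      unfolding I'_def M'_def q_def using insert.hyps insert.prems(3) pivot P1(1)
      by (intro ballI indep_columns_eliminate) auto
    show "\<forall>a\<in>P1. \<forall>j\<in>J. \<forall>k\<in>N. (\<Sum>i\<in>I'. z j i a * M' i k a) = w' j k a"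
    proof (intro ballI)
      fix a j k' assume a: "a \<in> P1" and "j \<in> J" "k' \<in> N"
      then have eq: "(\<Sum>i\<in>I. z j i a * M i k' a) = w j k' a" "(\<Sum>i\<in>I. z j i a * M i k a) = w j k a"
        using insert.prems(4) P1(1) by auto
      have "M' i0 k' a = 0" using pivot[OF a] by (simp add: M'_def q_def)
      then have "(\<Sum>i\<in>I'. z j i a * M' i k' a) = (\<Sum>i\<in>I. z j i a * M' i k' a)"
        using insert.prems(1) i0(1) by (simp add: I'_def sum_diff1)
      also have "\<dots> = w' j k' a"
        by (simp add: M'_def w'_def right_diff_distrib sum_subtractf sum_distrib_right mult.assoc
            flip: eq)
      finally show "(\<Sum>i\<in>I'. z j i a * M' i k' a) = w' j k' a" .
    qed
    show "\<forall>k\<in>N. \<forall>i\<in>I'. rational_on P1 T (M' i k)"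
      unfolding M'_def[abs_def] I'_def
      by (intro ballI rational_on_diff rational_on.mult ratM ratq) auto
    show "\<forall>k\<in>N. \<forall>j\<in>J. rational_on P1 T (w' j k)"
      unfolding w'_def[abs_def]
      by (intro ballI rational_on_diff rational_on.mult ratw ratq) auto
  qed (rule P1(2))
  then obtain P' R where P': "P' \<subseteq> P1" "L P'" and R: "R \<subseteq> I'" "card R = card N"
    and rat: "\<forall>j\<in>J. \<forall>i\<in>I'. rational_on P' (T \<union> {z j i | j i. j \<in> J \<and> i \<in> I' - R}) (z j i)"
    by (elim exE conjE)
  define T' where "T' = T \<union> {z j i | j i. j \<in> J \<and> i \<in> I - insert i0 R}"
  have I': "I' - R = I - insert i0 R" by (auto simp: I'_def)
  have rat': "rational_on P' T' (z j i)" if "j \<in> J" "i \<in> I'" for j i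
    using rat that by (simp add: T'_def I')
  have T: "T \<subseteq> T'" by (auto simp: T'_def)
  have "rational_on P' T' (z j i)" if "j \<in> J" "i \<in> I" for j i
  proof (cases "i = i0")
    case True
    have "rational_on P' T' (\<lambda>a. (w j k a - (\<Sum>i\<in>I'. z j i a * M i k a)) / M i0 k a)"
    proof (intro rational_on_divide rational_on_diff rational_on_sum rational_on.mult)
      show "rational_on P' T' (w j k)" using ratw[OF that(1), of k] P'(1) T rational_on_mono by blast
      show "rational_on P' T' (M i k)" if "i \<in> I'" for i
        using ratM[of i k] that P'(1) T rational_on_mono by (auto simp: I'_def)
      show "rational_on P' T' (M i0 k)"
        using ratM[of i0 k] i0(1) P'(1) T rational_on_mono by auto
      show "M i0 k a \<noteq> 0" if "a \<in> P'" for a using pivot that P'(1) by blast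
    qed (use rat' that in auto)
    then show ?thesis
    proof (rule rational_on.cong)
      fix a assume "a \<in> P'"
      then have a: "a \<in> P1" "a \<in> P" using P'(1) P1(1) by auto
      then have "w j k a = (\<Sum>i\<in>I. z j i a * M i k a)" using insert.prems(4) that by auto
      also have "\<dots> = z j i0 a * M i0 k a + (\<Sum>i\<in>I'. z j i a * M i k a)"
        unfolding I'_def using insert.prems(1) i0(1) by (rule sum.remove)
      finally show "z j i a = (w j k a - (\<Sum>i\<in>I'. z j i a * M i k a)) / M i0 k a"
        using pivot[OF a(1)] True by simp
    qed
  qed (use rat' that in \<open>simp add: I'_def\<close>)
  moreover have "card (insert i0 R) = card (insert k N)"
  proof -
    have "finite R" using R(1) insert.prems(1) finite_subset[of R I] by (auto simp: I'_def)
    then show ?thesis using R insert.hyps by (auto simp: I'_def card_insert_if)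
  qed
  moreover have "insert i0 R \<subseteq> I" using R(1) i0(1) by (auto simp: I'_def)
  moreover have "P' \<subseteq> P" using P'(1) P1(1) by blast
  ultimately show ?case
    unfolding T'_def using P'(2) by (intro exI[of _ P'] exI[of _ "insert i0 R"]) simp
qed

definition rational_mat :: "'n set \<Rightarrow> 'a set \<Rightarrow> ('a \<Rightarrow> 'k::field) set \<Rightarrow> ('a \<Rightarrow> ('n, 'k) matrix) \<Rightarrow> bool" where
  "rational_mat I P T A \<longleftrightarrow> (\<forall>i\<in>I. \<forall>j\<in>I. rational_on P T (\<lambda>a. A a i j))"

lemma rational_mat_add:
  "rational_mat I P T A \<Longrightarrow> rational_mat I P T B \<Longrightarrow> rational_mat I P T (\<lambda>a. A a + B a)"
  by (auto simp: rational_mat_def intro!: rational_on.add)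

lemma rational_mat_diff:
  "rational_mat I P T A \<Longrightarrow> rational_mat I P T B \<Longrightarrow> rational_mat I P T (\<lambda>a. A a - B a)"
  by (auto simp: rational_mat_def intro!: rational_on_diff)

lemma rational_mat_mmul:
  "rational_mat I P T A \<Longrightarrow> rational_mat I P T B \<Longrightarrow> rational_mat I P T (\<lambda>a. mmul I (A a) (B a))"
  by (auto simp: rational_mat_def mmul_def intro!: rational_on_sum rational_on.mult)

lemma rational_mat_const: "rational_mat I P T (\<lambda>a. A)"
  by (auto simp: rational_mat_def intro!: rational_on.const)

lemma rational_mat_supported:
  assumes "\<forall>a\<in>P. supported R S (A a)" "\<And>i j. i \<in> R \<Longrightarrow> j \<in> S \<Longrightarrow> rational_on P T (\<lambda>a. A a i j)"
  shows "rational_mat I P T A"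
  unfolding rational_mat_def
proof (intro ballI)
  fix i j
  show "rational_on P T (\<lambda>a. A a i j)"
  proof (cases "i \<in> R \<and> j \<in> S")
    case False
    then show ?thesis
      using assms(1) by (intro rational_on.cong[OF rational_on.const[of P T 0]]) (auto simp: supported_def)
  qed (use assms(2) in auto)
qed

lemma rational_mat_mono:
  assumes "rational_mat I P T A" "P' \<subseteq> P" "T \<subseteq> T'"
  shows "rational_mat I P' T' A"
  unfolding rational_mat_def
proof (intro ballI)
  fix i j assume "i \<in> I" "j \<in> I"
  then have "rational_on P T (\<lambda>a. A a i j)" using assms(1) by (simp add: rational_mat_def)
  then show "rational_on P' T' (\<lambda>a. A a i j)" using assms(2,3) by (rule rational_on_mono)
qed

lemma rational_mat_cong:
  "rational_mat I P T B \<Longrightarrow> (\<And>a. a \<in> P \<Longrightarrow> A a = B a) \<Longrightarrow> rational_mat I P T A"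
  unfolding rational_mat_def
  by (intro ballI, rule rational_on.cong[where f = "\<lambda>a. B a i j" for i j]) auto

lemma card_entries_le:
  assumes "finite A" "finite B"
  shows "finite {f i j | i j. i \<in> A \<and> j \<in> B}" "card {f i j | i j. i \<in> A \<and> j \<in> B} \<le> card A * card B"
proof -
  have eq: "{f i j | i j. i \<in> A \<and> j \<in> B} = (\<lambda>(i, j). f i j) ` (A \<times> B)" by auto
  show "finite {f i j | i j. i \<in> A \<and> j \<in> B}" unfolding eq using assms by simp
  show "card {f i j | i j. i \<in> A \<and> j \<in> B} \<le> card A * card B"
    unfolding eq card_cartesian_product[symmetric] using assms by (intro card_image_le) simp
qed

section \<open>The dimension of the representation variety of the Jordan plane\<close>

text \<open>
  With \<open>m = card N\<close> and \<open>r = card J\<close>, the parameters are the \<open>m\<^sup>2\<close> of \<open>D\<close> and \<open>E\<close> given by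
  induction, the \<open>m r\<close> entries of \<open>H\<close>, the \<open>r m\<close> entries of \<open>C\<close>, and the \<open>r\<^sup>2\<close> entries of \<open>Z = (A B)\<close>
  that are left free by the equation \<open>Z (C + E) = C (D + E)\<close>.
\<close>

lemma jordan_pairs_rational:
  fixes X Y :: "'a \<Rightarrow> ('n, 'k::field_char_0) matrix"
  assumes L: "partition_regular L" and "finite I" "L P"
    and "\<forall>a\<in>P. supported I I (X a) \<and> supported I I (Y a) \<and>
      mmul I (X a) (Y a) = mmul I (Y a) (X a) + mmul I (Y a) (Y a)"
  shows "\<exists>P' T. P' \<subseteq> P \<and> L P' \<and> finite T \<and> card T \<le> (card I)\<^sup>2 \<and>
    rational_mat I P' T X \<and> rational_mat I P' T Y"
  using assms(2-4)
proof (induction I arbitrary: P X Y rule: finite_psubset_induct)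
  case (psubset I)
  show ?case
  proof (cases "I = {}")
    case True
    then show ?thesis
      using psubset.prems(1) by (intro exI[of _ P] exI[of _ "{}"]) (simp add: rational_mat_def)
  next
    case False
    have pair: "supported I I (X a)" "supported I I (Y a)"
      "mmul I (X a) (Y a) = mmul I (Y a) (X a) + mmul I (Y a) (Y a)" if "a \<in> P" for a
      using psubset.prems(2) that by blast+
    define good where "good a N H \<longleftrightarrow> N \<subseteq> I \<and> indep_columns I N (Y a) \<and> supported N (I - N) H \<and>
      (\<forall>i\<in>I. \<forall>j\<in>I - N. Y a i j = (\<Sum>k\<in>N. Y a i k * H k j))" for a N H
    have "\<exists>N H. good a N H" for a
      using column_basis[OF psubset.hyps, of "Y a"] by (auto simp: good_def)
    then have "\<exists>n. \<forall>a. \<exists>H. good a (n a) H" by (intro choice allI)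
    then obtain n where "\<forall>a. \<exists>H. good a (n a) H" ..
    then have "\<exists>H. \<forall>a. good a (n a) (H a)" by (rule choice)
    then obtain H where nH: "\<forall>a. good a (n a) (H a)" ..
    \<comment> \<open>The set of basis columns varies with the point, so pass to a large set where it is constant.\<close>
    have "\<exists>N\<in>Pow I. L {a \<in> P. n a = N}"
      using psubset.hyps psubset.prems(1) nH
      by (intro partition_regular_pigeonhole[OF L]) (auto simp: good_def)
    then obtain N where "N \<in> Pow I" and LN: "L {a \<in> P. n a = N}" ..
    define P1 where "P1 = {a \<in> P. n a = N}"
    have P1: "P1 \<subseteq> P" "L P1" using LN by (auto simp: P1_def)
    have N: "N \<subseteq> I" "finite N" using \<open>N \<in> Pow I\<close> psubset.hyps finite_subset by auto
    have good: "good a N (H a)" if "a \<in> P1" for a using nH that by (auto simp: P1_def)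
    have split: "jordan_splitting I N (X a) (Y a) (H a)" if "a \<in> P1" for a
    proof (rule jordan_splitting.intro)
      show "mmul I (X a) (Y a) = mmul I (Y a) (X a) + mmul I (Y a) (Y a)"
        using pair that P1(1) by blast
    qed (use psubset.hyps pair that P1(1) good[OF that] in \<open>auto simp: good_def\<close>)
    have "N \<noteq> I"
    proof
      assume "N = I"
      obtain a where a: "a \<in> P1" using P1(2) L by (metis equals0I partition_regular_def)
      then have "indep_columns I I (Y a)" using good \<open>N = I\<close> by (auto simp: good_def)
      then have "I = {}"
        using jordan_pair_singular[OF psubset.hyps, of "X a" "Y a"] pair a P1(1) by blast
      with False show False ..
    qed
    define J where "J = I - N"
    have J: "finite J" "card I = card N + card J"
      using psubset.hyps N by (auto simp: J_def card_Diff_subset card_mono)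
    define D where "D a = jordan_splitting.quot I N (H a) (X a)" for a
    define E where "E a = jordan_splitting.quot I N (H a) (Y a)" for a
    define C where "C a = jordan_splitting.corner I N (Y a)" for a
    define Z where "Z a = jordan_splitting.upper I N (X a) (H a)" for a
    define p where "p a = jordan_splitting.proj N (H a)" for a
    note defs = D_def E_def C_def Z_def p_def
    have "\<exists>P' T. P' \<subseteq> P1 \<and> L P' \<and> finite T \<and> card T \<le> (card N)\<^sup>2 \<and>
        rational_mat N P' T D \<and> rational_mat N P' T E"
    proof (rule psubset.IH)
      show "N \<subset> I" using N \<open>N \<noteq> I\<close> by blast
      show "\<forall>a\<in>P1. supported N N (D a) \<and> supported N N (E a) \<and>
          mmul N (D a) (E a) = mmul N (E a) (D a) + mmul N (E a) (E a)"
        unfolding defs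
        by (intro ballI conjI jordan_splitting.supp_quot[OF split]
            jordan_splitting.quot_jordan[OF split])
    qed (rule P1(2))
    then obtain P2 T2 where P2: "P2 \<subseteq> P1" "L P2" and T2: "finite T2" "card T2 \<le> (card N)\<^sup>2"
      and DE: "rational_mat N P2 T2 D" "rational_mat N P2 T2 E" by (elim exE conjE)
    define TH where "TH = {\<lambda>a. H a i j | i j. i \<in> N \<and> j \<in> J}"
    define TC where "TC = {\<lambda>a. C a i j | i j. i \<in> J \<and> j \<in> N}"
    define T3 where "T3 = T2 \<union> TH \<union> TC"
    have suppD: "supported N N (D a)" "supported N N (E a)" if "a \<in> P2" for a
      using split[of a] that P2(1) by (auto simp: defs jordan_splitting.supp_quot)
    have suppH: "supported N J (H a)" if "a \<in> P2" for a
      using good[of a] that P2(1) by (auto simp: good_def J_def)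
    have suppC: "supported J N (C a)" if "a \<in> P2" for a
      using split[of a] that P2(1) by (auto simp: defs J_def jordan_splitting.supp_corner)
    have suppZ: "supported J I (Z a)" if "a \<in> P2" for a
      using split[of a] that P2(1) by (auto simp: defs J_def jordan_splitting.supp_upper)
    have rat3: "rational_mat I P2 T3 D" "rational_mat I P2 T3 E" "rational_mat I P2 T3 H"
      "rational_mat I P2 T3 C"
    proof -
      have *: "rational_mat I P2 T3 A"
        if "rational_mat N P2 T2 A" "\<forall>a\<in>P2. supported N N (A a)" for A :: "'a \<Rightarrow> ('n, 'k) matrix"
        using that(2)
      proof (rule rational_mat_supported)
        fix i j assume "i \<in> N" "j \<in> N"
        then have "rational_on P2 T2 (\<lambda>a. A a i j)" using that(1) by (simp add: rational_mat_def)
        then show "rational_on P2 T3 (\<lambda>a. A a i j)" by (rule rational_on_mono) (auto simp: T3_def)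
      qed
      show "rational_mat I P2 T3 D" "rational_mat I P2 T3 E"
        using * DE suppD by blast+
      have "rational_on P2 T3 (\<lambda>a. H a i j)" if "i \<in> N" "j \<in> J" for i j
        using that by (intro rational_on.base) (auto simp: T3_def TH_def)
      then show "rational_mat I P2 T3 H"
        using suppH by (intro rational_mat_supported[of P2 N J]) auto
      have "rational_on P2 T3 (\<lambda>a. C a i j)" if "i \<in> J" "j \<in> N" for i j
        using that by (intro rational_on.base) (auto simp: T3_def TC_def)
      then show "rational_mat I P2 T3 C"
        using suppC by (intro rational_mat_supported[of P2 J N]) auto
    qed
    have "\<exists>P' R. P' \<subseteq> P2 \<and> L P' \<and> R \<subseteq> I \<and> card R = card N \<and>
        (\<forall>j\<in>J. \<forall>i\<in>I. rational_on P' (T3 \<union> {\<lambda>a. Z a j i | j i. j \<in> J \<and> i \<in> I - R}) (\<lambda>a. Z a j i))"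
    proof (rule eliminate_unknowns[OF L N(2) psubset.hyps P2(2),
          where M = "\<lambda>i k a. (C a + E a) i k" and w = "\<lambda>j k a. mmul I (C a) (D a + E a) j k"])
      show "\<forall>a\<in>P2. indep_columns I N (\<lambda>i k. (C a + E a) i k)"
      proof
        fix a assume "a \<in> P2"
        then have "indep_columns I N (C a + E a)"
          unfolding defs using split P2(1) by (intro jordan_splitting.indep_corner_quot) auto
        then show "indep_columns I N (\<lambda>i k. (C a + E a) i k)" .
      qed
      show "\<forall>a\<in>P2. \<forall>j\<in>J. \<forall>k\<in>N. (\<Sum>i\<in>I. Z a j i * (C a + E a) i k) = mmul I (C a) (D a + E a) j k"
      proof (intro ballI)
        fix a j k assume "a \<in> P2"
        then have "mmul I (Z a) (C a + E a) = mmul I (C a) (D a + E a)"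
          unfolding defs using split P2(1) by (intro jordan_splitting.upper_equation) auto
        then show "(\<Sum>i\<in>I. Z a j i * (C a + E a) i k) = mmul I (C a) (D a + E a) j k"
          by (metis mmul_def)
      qed
      show "\<forall>k\<in>N. \<forall>i\<in>I. rational_on P2 T3 (\<lambda>a. (C a + E a) i k)"
        using rational_mat_add[OF rat3(4,2)] N(1) unfolding rational_mat_def by blast
      show "\<forall>k\<in>N. \<forall>j\<in>J. rational_on P2 T3 (\<lambda>a. mmul I (C a) (D a + E a) j k)"
        using rational_mat_mmul[OF rat3(4) rational_mat_add[OF rat3(1,2)]] N(1)
        unfolding rational_mat_def J_def by blast
    qed
    then obtain P3 R where P3: "P3 \<subseteq> P2" "L P3" and R: "R \<subseteq> I" "card R = card N"
      and ratZ: "\<forall>j\<in>J. \<forall>i\<in>I.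
        rational_on P3 (T3 \<union> {\<lambda>a. Z a j i | j i. j \<in> J \<and> i \<in> I - R}) (\<lambda>a. Z a j i)"
      by (elim exE conjE)
    define TZ where "TZ = {\<lambda>a. Z a j i | j i. j \<in> J \<and> i \<in> I - R}"
    define T where "T = T3 \<union> TZ"
    have mono: "rational_mat I P3 T A" if "rational_mat I P2 T3 A" for A :: "'a \<Rightarrow> ('n, 'k) matrix"
      using that P3(1) by (rule rational_mat_mono) (simp add: T_def)
    have rat: "rational_mat I P3 T D" "rational_mat I P3 T E" "rational_mat I P3 T H"
      "rational_mat I P3 T C"
      by (rule mono[OF rat3(1)] mono[OF rat3(2)] mono[OF rat3(3)] mono[OF rat3(4)])+
    have ratZ': "rational_mat I P3 T Z"
      using ratZ suppZ P3(1) by (intro rational_mat_supported[of P3 J I]) (auto simp: T_def TZ_def)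
    have split3: "jordan_splitting I N (X a) (Y a) (H a)" if "a \<in> P3" for a
      using split that P2(1) P3(1) by blast
    have "rational_mat I P3 T (\<lambda>a. diag_one N + H a)"
      by (intro rational_mat_add rational_mat_const rat)
    then have ratp: "rational_mat I P3 T p"
      by (rule rational_mat_cong) (simp only: p_def jordan_splitting.proj_def[OF split3])
    have "rational_mat I P3 T (\<lambda>a. mmul I (C a) (p a) + mmul I (E a) (p a)
        - mmul I (H a) (mmul I (C a) (p a)))"
      by (intro rational_mat_add rational_mat_diff rational_mat_mmul rat ratp)
    then have "rational_mat I P3 T Y"
      by (rule rational_mat_cong) (unfold defs, rule jordan_splitting.reconstruct_Y[OF split3])
    moreover define Q where
      "Q a = mmul I (Z a) (diag_one J) + mmul I (mmul I (Z a) (diag_one N)) (p a)" for a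
    have "rational_mat I P3 T (\<lambda>a. Q a + mmul I (D a) (p a) - mmul I (H a) (Q a))"
      unfolding Q_def
      by (intro rational_mat_add rational_mat_diff rational_mat_mmul rational_mat_const rat ratp ratZ')
    then have "rational_mat I P3 T X"
      by (rule rational_mat_cong)
        (unfold Q_def defs J_def, rule jordan_splitting.reconstruct_X[OF split3])
    moreover have "finite T \<and> card T \<le> (card I)\<^sup>2"
    proof -
      have H: "finite TH" "card TH \<le> card N * card J"
        unfolding TH_def by (rule card_entries_le N J)+
      have C: "finite TC" "card TC \<le> card J * card N"
        unfolding TC_def by (rule card_entries_le N J)+
      have IR: "finite (I - R)" "card (I - R) = card J"
        using psubset.hyps R J(2) finite_subset[OF R(1)] by (auto simp: card_Diff_subset)
      have Z: "finite TZ" "card TZ \<le> card J * card J"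
        using card_entries_le[OF J(1) IR(1), of "\<lambda>j i a. Z a j i"] by (simp_all add: TZ_def IR(2))
      have "card T \<le> card T2 + card TH + card TC + card TZ"
        unfolding T_def T3_def
        by (meson add_le_mono1 card_Un_le order_trans)
      also have "\<dots> \<le> (card N)\<^sup>2 + card N * card J + card J * card N + card J * card J"
        using T2 H C Z by linarith
      also have "\<dots> = (card I)\<^sup>2" by (simp add: J(2) power2_eq_square algebra_simps)
      finally show ?thesis using T2 H C Z by (simp add: T_def T3_def)
    qed
    moreover have "P3 \<subseteq> P" using P1(1) P2(1) P3(1) by blast
    ultimately show ?thesis using P3(2) by blast
  qed
qed

lemma variety_dim_jordan:
  "variety_dim (mat_coords n) (rep_variety jordan_plane_relations n) = ereal (real (n\<^sup>2))"
proof (rule antisym)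
  let ?I = "mat_coords n :: (jordan_gen \<times> nat \<times> nat) set"
  let ?V = "rep_variety jordan_plane_relations n"
  define X where "X a = (\<lambda>i j. if i < n \<and> j < n then a (GenX, i, j) else 0)"
    for a :: "jordan_gen \<times> nat \<times> nat \<Rightarrow> complex"
  define Y where "Y a = (\<lambda>i j. if i < n \<and> j < n then a (GenY, i, j) else 0)"
    for a :: "jordan_gen \<times> nat \<times> nat \<Rightarrow> complex"
  have supp: "supported {..<n} {..<n} (X a)" "supported {..<n} {..<n} (Y a)" for a
    by (auto simp: supported_def X_def Y_def)
  have jordan: "mmul {..<n} (X a) (Y a) = mmul {..<n} (Y a) (X a) + mmul {..<n} (Y a) (Y a)"
    if "a \<in> ?V" for a
  proof (intro ext)
    fix i j
    let ?X = "mat_at n a GenX" and ?Y = "mat_at n a GenY"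
    have zero: "?X * ?Y - ?Y * ?X - ?Y * ?Y = 0\<^sub>m n n"
      using that by (simp add: rep_variety_jordan_plane Let_def)
    have entry: "(mat_at n a u * mat_at n a v) $$ (i, j) = (\<Sum>k<n. a (u, i, k) * a (v, k, j))"
      if "i < n" "j < n" for u v
      using that by (simp add: mat_at_def scalar_prod_def atLeast0LessThan)
    show "mmul {..<n} (X a) (Y a) i j = (mmul {..<n} (Y a) (X a) + mmul {..<n} (Y a) (Y a)) i j"
    proof (cases "i < n \<and> j < n")
      case True
      then have "(?X * ?Y - ?Y * ?X - ?Y * ?Y) $$ (i, j) =
          (?X * ?Y) $$ (i, j) - (?Y * ?X) $$ (i, j) - (?Y * ?Y) $$ (i, j)"
        by (simp add: mat_at_def)
      with zero True show ?thesis
        by (simp add: entry mmul_def X_def Y_def diff_eq_eq add.commute)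
    next
      case False
      then show ?thesis by (auto simp: mmul_def X_def Y_def)
    qed
  qed
  show "variety_dim ?I ?V \<le> ereal (real (n\<^sup>2))"
  proof (rule variety_dim_le)
    fix Z assume Z: "irreducible_closed ?I Z" "Z \<subseteq> ?V"
    have "partition_regular (dense_in ?I Z)"
      unfolding partition_regular_def
    proof (intro conjI allI impI)
      obtain z where "z \<in> Z" using Z(1) by (auto simp: irreducible_closed_def)
      then show "\<not> dense_in ?I Z {}"
        using dense_in_zero[of ?I Z "{}" "\<lambda>_. 1" z] poly_fun_const[of ?I "1::complex"] by auto
    qed (rule dense_in_Un[OF Z(1)])
    moreover have "dense_in ?I Z Z" by (simp add: dense_in_def)
    ultimately have "\<exists>P T. P \<subseteq> Z \<and> dense_in ?I Z P \<and> finite T \<and> card T \<le> (card {..<n})\<^sup>2 \<and>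
        rational_mat {..<n} P T X \<and> rational_mat {..<n} P T Y"
      using supp jordan Z(2) by (intro jordan_pairs_rational) auto
    then obtain P T where PT: "dense_in ?I Z P" "finite T" "card T \<le> n\<^sup>2"
      and rat: "rational_mat {..<n} P T X" "rational_mat {..<n} P T Y" by auto
    have "rational_on P T (\<lambda>a. a c)" if c: "c \<in> ?I" for c
    proof -
      obtain u i j where c: "c = (u, i, j)" "i < n" "j < n"
        using c by (auto simp: mat_coords_def)
      have "rational_on P T (\<lambda>a. X a i j)" "rational_on P T (\<lambda>a. Y a i j)"
        using rat c by (auto simp: rational_mat_def)
      then show ?thesis using c by (cases u) (simp_all add: X_def Y_def)
    qed
    with PT show "\<exists>P T. dense_in ?I Z P \<and> finite T \<and> card T \<le> n\<^sup>2 \<and> (\<forall>c\<in>?I. rational_on P T (\<lambda>a. a c))"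
      by blast
  qed
  \<comment> \<open>All points with \<open>Y = 0\<close> are representations.\<close>
  let ?K = "{GenX} \<times> {..<n} \<times> {..<n}"
  have "coord_subspace ?I ?K \<subseteq> ?V"
  proof
    fix a :: "jordan_gen \<times> nat \<times> nat \<Rightarrow> complex"
    assume a: "a \<in> coord_subspace ?I ?K"
    then have "mat_at n a GenY = 0\<^sub>m n n"
      by (intro eq_matI) (auto simp: mat_at_def coord_subspace_def mat_coords_def)
    moreover have "mat_at n a GenX \<in> carrier_mat n n" by (simp add: mat_at_def)
    ultimately show "a \<in> ?V" using a
      by (auto simp: rep_variety_jordan_plane coord_subspace_def Let_def)
  qed
  then have "ereal (real (card ?K)) \<le> variety_dim ?I ?V"
    by (intro variety_dim_ge_coord_subspace) (auto simp: mat_coords_def infinite_UNIV_char_0)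
  then show "ereal (real (n\<^sup>2)) \<le> variety_dim ?I ?V"
    by (simp add: card_cartesian_product power2_eq_square)
qed

theorem theorem14p4:
  shows "RCI jordan_plane_relations"
proof -
  have "CARD(jordan_gen) = 2" by (simp add: UNIV_jordan_gen)
  moreover have "length jordan_plane_relations = 1"
    by (simp add: jordan_plane_relations_def Let_def)
  ultimately have "rep_complete_intersection jordan_plane_relations n" for n
    by (simp add: rep_complete_intersection_def variety_dim_jordan)
  then have "{n. n \<ge> 1 \<and> rep_complete_intersection jordan_plane_relations n} = {1..}" by auto
  then show ?thesis by (simp add: RCI_def infinite_Ici)
qed

end
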